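(* For any polynomial function $\alpha(n)$, there is a $\Theta(n)$-vertex graph $G$ of diameter $\Theta(\log n)$, together with a spanning tree $T\subseteq G$ of height $h=\Theta(\sqrt{n}/\log n)$, such that any (even randomized) distributed $\alpha(n)$-approximation algorithm for weighted TAP on the instance tree $T$ requires $\Omega(h)$ rounds in the CONGEST model.
   Context: CONGEST model: the network is an undirected connected $n$-vertex graph $G$; synchronous rounds, each vertex sends an $O(\log n)$-bit message to each neighbour per round. Weighted TAP: input is a $2$-edge-connected graph $G$ with non-negative edge weights and a rooted spanning tree $T$ of $G$ (each vertex knows its incident tree edges and its parent); output is a set $Aug$ of edges of $G$ with $T\cup Aug$ $2$-edge-connected (each vertex knows which incident edges are in $Aug$), minimizing total weight. An $\alpha(n)$-approximation outputs an augmentation of weight at most $\alpha(n)$ times the optimum. The height $h$ of $T$ is the maximum root-to-vertex distance in $T$. *)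

theory Defs
  imports "HOL-Probability.Probability" "HOL-Library.Landau_Symbols"
begin

record ugraph =
  verts :: "nat set"
  edges :: "nat set set"

definition simple_graph :: "ugraph \<Rightarrow> bool" where
  "simple_graph G \<longleftrightarrow>
     finite (verts G) \<and>
     edges G \<subseteq> {{u, v} | u v. u \<in> verts G \<and> v \<in> verts G \<and> u \<noteq> v}"

definition adj :: "ugraph \<Rightarrow> (nat \<times> nat) set" where
  "adj G = {(u, v). {u, v} \<in> edges G}"

definition connected_graph :: "ugraph \<Rightarrow> bool" where
  "connected_graph G \<longleftrightarrow>
     verts G \<noteq> {} \<and> (\<forall>u\<in>verts G. \<forall>v\<in>verts G. (u, v) \<in> (adj G)\<^sup>*)"

definition two_edge_connected :: "ugraph \<Rightarrow> bool" where
  "two_edge_connected G \<longleftrightarrow>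
     connected_graph G \<and> (\<forall>e\<in>edges G. connected_graph (G\<lparr>edges := edges G - {e}\<rparr>))"

text \<open>Only meaningful when \<open>v\<close> is reachable from \<open>u\<close>.\<close>

definition graph_dist :: "ugraph \<Rightarrow> nat \<Rightarrow> nat \<Rightarrow> nat" where
  "graph_dist G u v = (LEAST k. (u, v) \<in> adj G ^^ k)"

definition graph_diameter :: "ugraph \<Rightarrow> nat" where
  "graph_diameter G = Max {graph_dist G u v | u v. u \<in> verts G \<and> v \<in> verts G}"

definition is_cycle :: "ugraph \<Rightarrow> nat list \<Rightarrow> bool" where
  "is_cycle G xs \<longleftrightarrow>
     3 \<le> length xs \<and> distinct xs \<and>
     successively (\<lambda>u v. {u, v} \<in> edges G) (xs @ [hd xs])"

text \<open>Spanning subgraphs of \<open>G\<close>, in particular spanning trees, are given by their edge sets;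
  \<open>spanning G F\<close> is the subgraph with all vertices of \<open>G\<close> and edge set \<open>F\<close>.\<close>

definition spanning :: "ugraph \<Rightarrow> nat set set \<Rightarrow> ugraph" where
  "spanning G F = G\<lparr>edges := F\<rparr>"

definition spanning_tree :: "ugraph \<Rightarrow> nat set set \<Rightarrow> bool" where
  "spanning_tree G T \<longleftrightarrow>
     T \<subseteq> edges G \<and> connected_graph (spanning G T) \<and> (\<nexists>xs. is_cycle (spanning G T) xs)"

definition tree_height :: "ugraph \<Rightarrow> nat set set \<Rightarrow> nat \<Rightarrow> nat" where
  "tree_height G T r = Max {graph_dist (spanning G T) r v | v. v \<in> verts G}"

definition tree_parent :: "ugraph \<Rightarrow> nat set set \<Rightarrow> nat \<Rightarrow> nat \<Rightarrow> nat option" where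
  "tree_parent G T r v =
     (if v = r then None
      else Some (THE u. {u, v} \<in> T \<and>
                  graph_dist (spanning G T) r v = Suc (graph_dist (spanning G T) r u)))"

definition augmentation :: "ugraph \<Rightarrow> nat set set \<Rightarrow> nat set set \<Rightarrow> bool" where
  "augmentation G T Aug \<longleftrightarrow>
     Aug \<subseteq> edges G \<and> two_edge_connected (spanning G (T \<union> Aug))"

definition tap_opt :: "ugraph \<Rightarrow> nat set set \<Rightarrow> (nat set \<Rightarrow> nat) \<Rightarrow> nat" where
  "tap_opt G T w = Min {(\<Sum>e\<in>Aug. w e) | Aug. augmentation G T Aug}"

definition approx_augmentation ::
    "ugraph \<Rightarrow> nat set set \<Rightarrow> (nat set \<Rightarrow> nat) \<Rightarrow> real \<Rightarrow> nat set set \<Rightarrow> bool" where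
  "approx_augmentation G T w a Aug \<longleftrightarrow>
     augmentation G T Aug \<and> real (\<Sum>e\<in>Aug. w e) \<le> a * real (tap_opt G T w)"

text \<open>Weights are integers that are polynomially bounded in the number of vertices, so that a
  weight fits into \<open>O(log n)\<close> bits.  Without any bound a fixed number of rounds with messages of
  bounded length could not suffice for correctness on all weight functions, whatever the number
  of rounds, and a lower bound would be void.\<close>

definition weight_fun :: "ugraph \<Rightarrow> nat \<Rightarrow> (nat set \<Rightarrow> nat) \<Rightarrow> bool" where
  "weight_fun G k w \<longleftrightarrow> (\<forall>e\<in>edges G. w e \<le> card (verts G) ^ k)"

type_synonym msg = "bool list"

text \<open>The initial knowledge of a vertex, except for its private coins.  The weight function is
  cut off outside the edges incident to the vertex.\<close>

record local_info =
  own_id :: nat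
  num_verts :: nat
  inc_edges :: "nat set set"
  inc_weight :: "nat set \<Rightarrow> nat"
  inc_tree_edges :: "nat set set"
  parent_id :: "nat option"

definition local_input ::
    "ugraph \<Rightarrow> nat set set \<Rightarrow> nat \<Rightarrow> (nat set \<Rightarrow> nat) \<Rightarrow> nat \<Rightarrow> local_info" where
  "local_input G T r w v =
     \<lparr>own_id = v,
      num_verts = card (verts G),
      inc_edges = {e \<in> edges G. v \<in> e},
      inc_weight = (\<lambda>e. if e \<in> edges G \<and> v \<in> e then w e else 0),
      inc_tree_edges = {e \<in> T. v \<in> e},
      parent_id = tree_parent G T r v\<rparr>"

text \<open>A vertex computes (with unbounded local power) from everything it has seen so far: its
  local input, its infinite sequence of coins, and the list of its inboxes of all previous
  rounds, an inbox mapping each neighbour to the message received from it.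
  \<open>send \<dots> u\<close> is the message for neighbour \<open>u\<close> in the next round, and \<open>result\<close> is the set of
  incident edges that the vertex declares to be in the augmentation.\<close>

record algorithm =
  send :: "local_info \<Rightarrow> (nat \<Rightarrow> bool) \<Rightarrow> (nat \<Rightarrow> msg) list \<Rightarrow> nat \<Rightarrow> msg"
  result :: "local_info \<Rightarrow> (nat \<Rightarrow> bool) \<Rightarrow> (nat \<Rightarrow> msg) list \<Rightarrow> nat set set"

text \<open>\<open>inboxes G I c A t v\<close> lists the inboxes of \<open>v\<close> in the first \<open>t\<close> rounds, for local inputs
  \<open>I\<close> and coins \<open>c\<close>.\<close>

primrec inboxes ::
    "ugraph \<Rightarrow> (nat \<Rightarrow> local_info) \<Rightarrow> (nat \<Rightarrow> nat \<Rightarrow> bool) \<Rightarrow> algorithm \<Rightarrow>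
     nat \<Rightarrow> nat \<Rightarrow> (nat \<Rightarrow> msg) list" where
  "inboxes G I c A 0 = (\<lambda>v. [])"
| "inboxes G I c A (Suc t) =
     (\<lambda>v. inboxes G I c A t v @
          [\<lambda>u. if {u, v} \<in> edges G then send A (I u) (c u) (inboxes G I c A t u) v else []])"

text \<open>Every vertex owns an infinite sequence of fair coins; all coins are independent.\<close>

definition coin_space :: "ugraph \<Rightarrow> (nat \<Rightarrow> nat \<Rightarrow> bool) measure" where
  "coin_space G =
     (\<Pi>\<^sub>M v\<in>verts G. \<Pi>\<^sub>M i\<in>(UNIV :: nat set). measure_pmf (bernoulli_pmf (1 / 2)))"

definition bandwidth_respected ::
    "ugraph \<Rightarrow> nat set set \<Rightarrow> nat \<Rightarrow> nat \<Rightarrow> algorithm \<Rightarrow> nat \<Rightarrow> nat \<Rightarrow> bool" where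
  "bandwidth_respected G T r k A B R \<longleftrightarrow>
     (\<forall>w c t u v. weight_fun G k w \<and> c \<in> space (coin_space G) \<and> t < R \<and> {u, v} \<in> edges G \<longrightarrow>
        (let I = local_input G T r w
         in length (send A (I u) (c u) (inboxes G I c A t u) v) \<le> B))"

text \<open>After \<open>R\<close> rounds the vertices hold a correct distributed output: for some set \<open>Aug\<close> as
  required, every vertex knows exactly which of its incident edges are in \<open>Aug\<close>.\<close>

definition run_succeeds ::
    "ugraph \<Rightarrow> nat set set \<Rightarrow> nat \<Rightarrow> (nat set \<Rightarrow> nat) \<Rightarrow> real \<Rightarrow> algorithm \<Rightarrow> nat \<Rightarrow>
     (nat \<Rightarrow> nat \<Rightarrow> bool) \<Rightarrow> bool" where
  "run_succeeds G T r w a A R c \<longleftrightarrow>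
     (let I = local_input G T r w
      in \<exists>Aug. approx_augmentation G T w a Aug \<and>
               (\<forall>v\<in>verts G. result A (I v) (c v) (inboxes G I c A R v) = {e \<in> Aug. v \<in> e}))"

text \<open>\<open>A\<close> is an \<open>R\<close>-round \<open>a\<close>-approximation algorithm with error probability at most \<open>\<epsilon>\<close> and
  \<open>B\<close>-bit messages for weighted tree augmentation on the network \<open>G\<close> with the rooted tree
  \<open>(T, r)\<close>.  Only the weights vary.  A non-measurable success event counts as failure, since
  \<^const>\<open>measure\<close> is then \<open>0\<close>; a deterministic algorithm is one that ignores the coins.\<close>

definition tap_algorithm ::
    "ugraph \<Rightarrow> nat set set \<Rightarrow> nat \<Rightarrow> nat \<Rightarrow> real \<Rightarrow> real \<Rightarrow> algorithm \<Rightarrow> nat \<Rightarrow> nat \<Rightarrow> bool" where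
  "tap_algorithm G T r k a \<epsilon> A B R \<longleftrightarrow>
     bandwidth_respected G T r k A B R \<and>
     (\<forall>w. weight_fun G k w \<longrightarrow>
        measure (coin_space G) {c \<in> space (coin_space G). run_succeeds G T r w a A R c}
          \<ge> 1 - \<epsilon>)"

end

theory Submission
  imports Defs "HOL-Real_Asymp.Real_Asymp"
begin

text \<open>The instance consists of about \<open>sqrt n * ln n\<close> legs of length about \<open>sqrt n / ln n\<close> and a
  spine of the same length, all hanging from a common root, with spine and legs made
  2-edge-connected by free edges; the spine carries free skip edges between positions \<open>j\<close> and
  \<open>j + 2 ^ k\<close>, which bring the diameter down to \<open>O(ln n)\<close>.  Leg \<open>i\<close> is joined to the spine by
  rungs.  All rungs cost \<open>1\<close>, except that the rung near the root is free unless \<open>i \<in> x\<close>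
  and the one at the far end is free unless \<open>i \<in> y\<close>.  The optimum is \<open>0\<close> if and only if \<open>x\<close> and \<open>y\<close>
  are disjoint, so an approximation with any factor decides disjointness: a positive rung is
  taken exactly if \<open>x\<close> and \<open>y\<close> meet.  As only \<open>O(ln n)\<close> skip edges cross a given position, two
  players can simulate \<open>R\<close> rounds (with \<open>R\<close> below a quarter of the leg length) by exchanging
  \<open>O(R * B * ln n)\<close> bits, while disjointness needs linearly many bits even with error
  probability \<open>\<epsilon> < 1 / 2\<close>.

  The lower bound for disjointness is Razborov's corruption argument.  In place of entropy it
  uses that in a family of \<open>2 ^ (card W - o(card W))\<close> subsets of \<open>W\<close> almost every
  element of \<open>W\<close> lies in about half of the members, so a rectangle that contains many
  disjoint pairs contains correspondingly many pairs meeting in one point.\<close>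

section \<open>Randomised communication complexity of disjointness\<close>

lemma exp_plus_exp_minus_le:
  fixes t :: real
  assumes "0 \<le> t" "t \<le> 1"
  shows "exp t + exp (- t) \<le> 2 * exp (t\<^sup>2)"
proof -
  have "exp t \<le> 1 + t + t\<^sup>2"
    using assms by (rule exp_bound)
  moreover have "exp (- t) \<le> 1 - t + t\<^sup>2"
  proof -
    have "1 \<le> (1 + t) * (1 - t + t\<^sup>2)"
      using assms by (simp add: algebra_simps power2_eq_square)
    also have "\<dots> \<le> exp t * (1 - t + t\<^sup>2)"
      using assms exp_ge_add_one_self[of t] by (intro mult_right_mono) auto
    finally show ?thesis
      by (simp add: exp_minus field_simps)
  qed
  moreover have "1 + t\<^sup>2 \<le> exp (t\<^sup>2)"
    by simp
  ultimately show ?thesis by linarith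
qed

text \<open>A Chernoff-type argument. Orient each coordinate in \<open>J\<close> towards its
  majority in \<open>F\<close>; the signed sum \<open>Z\<close> then averages at least
  \<open>\<eta> * m\<close> over \<open>F\<close>. Convexity bounds the sum of
  \<open>exp (t * Z x)\<close> over \<open>F\<close> from below, while over the whole cube this sum
  factorises and is at most \<open>2 ^ card W * exp (t\<^sup>2 * m)\<close>.\<close>

lemma card_family_le_of_biased:
  fixes F :: "'a set set" and \<eta> :: real
  assumes W: "finite W" and F: "F \<subseteq> Pow W" and J: "J \<subseteq> W" and \<eta>: "0 < \<eta>" "\<eta> \<le> 1"
    and biased: "\<And>i. i \<in> J \<Longrightarrow>
      \<eta> * card F \<le> \<bar>real (card {x \<in> F. i \<in> x}) - real (card {x \<in> F. i \<notin> x})\<bar>"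
  shows "card F * exp (\<eta>\<^sup>2 / 4 * card J) \<le> 2 ^ card W"
proof -
  define diff where "diff i = real (card {x \<in> F. i \<in> x}) - real (card {x \<in> F. i \<notin> x})" for i
  define s :: "'a \<Rightarrow> real" where "s i = (if 0 \<le> diff i then 1 else - 1)" for i
  \<comment> \<open>This value maximises \<open>t * \<eta> - t\<^sup>2\<close> and yields the
    exponent \<open>\<eta>\<^sup>2 / 4\<close>.\<close>
  define t where "t = \<eta> / 2"
  define Z where "Z x = (\<Sum>i\<in>J. s i * (if i \<in> x then 1 else - 1))" for x
  define m where "m = real (card J)"
  have fin: "finite F" "finite J"
    using W F J by (auto intro: finite_subset)
  have s_diff: "s i * diff i = \<bar>diff i\<bar>" for i
    by (simp add: s_def)
  have "(\<Sum>x\<in>F. Z x) = (\<Sum>i\<in>J. s i * (\<Sum>x\<in>F. if i \<in> x then 1 else - 1))"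
    unfolding Z_def by (subst sum.swap) (simp add: sum_distrib_left)
  also have "\<dots> = (\<Sum>i\<in>J. s i * diff i)"
  proof (intro sum.cong refl)
    fix i
    have "F \<inter> - {x. i \<in> x} = {x \<in> F. i \<notin> x}" "F \<inter> {x. i \<in> x} = {x \<in> F. i \<in> x}" by auto
    then show "s i * (\<Sum>x\<in>F. if i \<in> x then 1 else - 1) = s i * diff i"
      using fin by (simp add: sum.If_cases diff_def)
  qed
  also have "\<dots> \<ge> (\<Sum>i\<in>J. \<eta> * card F)"
    using biased by (intro sum_mono) (simp add: s_diff, simp add: diff_def)
  finally have sumZ: "\<eta> * card F * m \<le> (\<Sum>x\<in>F. Z x)"
    by (simp add: m_def mult_ac)
  \<comment> \<open>Jensen's inequality by hand: \<open>exp\<close> lies above its tangent at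
    \<open>t * \<eta> * m\<close>, and the linear term is nonnegative by
    \<open>sumZ\<close>.\<close>
  have "card F * exp (t * \<eta> * m) \<le> exp (t * \<eta> * m) * (card F + t * ((\<Sum>x\<in>F. Z x) - \<eta> * card F * m))"
    using sumZ \<eta> by (simp add: t_def)
  also have "\<dots> = (\<Sum>x\<in>F. exp (t * \<eta> * m) * (1 + (t * Z x - t * \<eta> * m)))"
    by (simp add: sum.distrib sum_subtractf algebra_simps sum_distrib_left sum_distrib_right)
  also have "\<dots> \<le> (\<Sum>x\<in>F. exp (t * \<eta> * m) * exp (t * Z x - t * \<eta> * m))"
    by (intro sum_mono mult_left_mono exp_ge_add_one_self) auto
  also have "\<dots> = (\<Sum>x\<in>F. exp (t * Z x))"
    by (simp add: exp_add[symmetric])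
  also have "\<dots> \<le> (\<Sum>x\<in>Pow W. exp (t * Z x))"
    using F W by (intro sum_mono2) auto
  \<comment> \<open>Each coordinate contributes one factor, chosen by membership in
    \<open>x\<close>, so that \<open>prod_add\<close> evaluates the sum over the cube
    coordinatewise.\<close>
  also have "\<dots> = (\<Sum>x\<in>Pow W. (\<Prod>i\<in>x. if i \<in> J then exp (t * s i) else 1)
      * (\<Prod>i\<in>W - x. if i \<in> J then exp (- (t * s i)) else 1))"
  proof (intro sum.cong refl)
    fix x assume "x \<in> Pow W"
    then have x: "x \<subseteq> W" "finite x" using W finite_subset by auto
    have "exp (t * Z x) = (\<Prod>i\<in>J. if i \<in> x then exp (t * s i) else exp (- (t * s i)))"
      using fin by (simp add: Z_def sum_distrib_left exp_sum if_distrib[of exp] if_distrib[of "(*) _"] cong: if_cong)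
    also have "\<dots> = (\<Prod>i\<in>W. if i \<in> J then (if i \<in> x then exp (t * s i) else exp (- (t * s i))) else 1)"
      using J W by (intro prod.mono_neutral_cong_left) auto
    also have "W = x \<union> (W - x)" using x by auto
    also have "(\<Prod>i\<in>x \<union> (W - x). if i \<in> J then (if i \<in> x then exp (t * s i) else exp (- (t * s i))) else 1)
       = (\<Prod>i\<in>x. if i \<in> J then exp (t * s i) else 1) * (\<Prod>i\<in>W - x. if i \<in> J then exp (- (t * s i)) else 1)"
      using x W by (subst prod.union_disjoint) (auto intro!: arg_cong2[where f="(*)"] prod.cong)
    finally show "exp (t * Z x) = \<dots>" .
  qed
  also have "\<dots> = (\<Prod>i\<in>W. (if i \<in> J then exp (t * s i) else 1) + (if i \<in> J then exp (- (t * s i)) else 1))"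
    using W by (rule prod_add[symmetric])
  also have "\<dots> \<le> (\<Prod>i\<in>W. 2 * (if i \<in> J then exp (t\<^sup>2) else 1))"
  proof (intro prod_mono)
    fix i
    have "exp t + exp (- t) \<le> 2 * exp (t\<^sup>2)"
      using \<eta> by (intro exp_plus_exp_minus_le) (auto simp: t_def)
    then show "0 \<le> (if i \<in> J then exp (t * s i) else 1) + (if i \<in> J then exp (- (t * s i)) else 1) \<and>
        (if i \<in> J then exp (t * s i) else 1) + (if i \<in> J then exp (- (t * s i)) else 1)
        \<le> 2 * (if i \<in> J then exp (t\<^sup>2) else 1)"
      by (auto simp: s_def add.commute intro!: add_nonneg_nonneg)
  qed
  also have "(\<Prod>i\<in>W. 2 * (if i \<in> J then exp (t\<^sup>2) else 1))
      = 2 ^ card W * (\<Prod>i\<in>W. if i \<in> J then exp (t\<^sup>2) else 1)"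
    by (simp only: prod.distrib prod_constant)
  also have "(\<Prod>i\<in>W. if i \<in> J then exp (t\<^sup>2) else 1) = (\<Prod>i\<in>J. exp (t\<^sup>2))"
    using J W by (intro prod.mono_neutral_cong_right) auto
  also have "\<dots> = exp (t\<^sup>2 * m)"
    by (simp add: m_def mult.commute exp_of_nat_mult[symmetric])
  finally have "card F * exp (t * \<eta> * m) * exp (- (t\<^sup>2 * m)) \<le> 2 ^ card W"
    by (simp add: exp_minus field_simps)
  then have "card F * exp (t * \<eta> * m - t\<^sup>2 * m) \<le> 2 ^ card W"
    by (simp add: exp_diff exp_minus field_simps)
  also have "t * \<eta> * m - t\<^sup>2 * m = \<eta>\<^sup>2 / 4 * m"
    by (simp add: t_def power2_eq_square algebra_simps)
  finally show ?thesis by (simp add: m_def)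
qed

section \<open>Double counting over splits of the ground set with a marked point\<close>

lemma sum_remove_point_swap:
  assumes "finite U"
  shows "(\<Sum>i\<in>U. \<Sum>S\<in>Pow (U - {i}). g i S) = (\<Sum>S\<in>Pow U. \<Sum>i\<in>U - S. g i S)"
proof -
  have "(\<Sum>i\<in>U. \<Sum>S\<in>Pow (U - {i}). g i S) = (\<Sum>i\<in>U. \<Sum>S | S \<in> Pow U \<and> i \<notin> S. g i S)"
    by (intro sum.cong) auto
  also have "\<dots> = (\<Sum>S\<in>Pow U. \<Sum>i | i \<in> U \<and> i \<notin> S. g i S)"
    using assms by (intro sum.swap_restrict) auto
  also have "\<dots> = (\<Sum>S\<in>Pow U. \<Sum>i\<in>U - S. g i S)"
    by (intro sum.cong) auto
  finally show ?thesis .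
qed

text \<open>Together with \<open>sum_remove_point_swap\<close> this passes between splits of
  \<open>U\<close> and splits of \<open>U - {i}\<close> in which the marked point \<open>i\<close>
  is added to the first or to the second part.\<close>

lemma sum_remove_point_insert:
  assumes "finite U"
  shows "(\<Sum>i\<in>U. \<Sum>S\<in>Pow (U - {i}). g i S) = (\<Sum>W\<in>Pow U. \<Sum>i\<in>W. g i (W - {i}))"
proof -
  have "(\<Sum>i\<in>U. \<Sum>S\<in>Pow (U - {i}). g i S) = (\<Sum>i\<in>U. \<Sum>W | W \<in> Pow U \<and> i \<in> W. g i (W - {i}))"
  proof (rule sum.cong[OF refl])
    fix i assume "i \<in> U"
    then show "(\<Sum>S\<in>Pow (U - {i}). g i S) = (\<Sum>W | W \<in> Pow U \<and> i \<in> W. g i (W - {i}))"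
      by (intro sum.reindex_bij_witness[where i = "\<lambda>W. W - {i}" and j = "insert i"])
        (auto simp: insert_absorb intro!: arg_cong[where f = "g i"])
  qed
  also have "\<dots> = (\<Sum>W\<in>Pow U. \<Sum>i | i \<in> U \<and> i \<in> W. g i (W - {i}))"
    using assms by (intro sum.swap_restrict) auto
  also have "\<dots> = (\<Sum>W\<in>Pow U. \<Sum>i\<in>W. g i (W - {i}))"
    by (intro sum.cong) auto
  finally show ?thesis .
qed

lemma sum_Pow_complement: "(\<Sum>S\<in>Pow V. g (V - S)) = (\<Sum>S\<in>Pow V. g S)"
  by (rule sum.reindex_bij_witness[where i = "\<lambda>S. V - S" and j = "\<lambda>S. V - S"]) auto

text \<open>The choices open to a player who holds the part \<open>W\<close>; products of two such
  counts make up the disjoint weight of a rectangle.\<close>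

definition below :: "'a set set \<Rightarrow> 'a set \<Rightarrow> real" where
  "below A W = card {x \<in> A. x \<subseteq> W}"

definition below_with :: "'a set set \<Rightarrow> 'a \<Rightarrow> 'a set \<Rightarrow> real" where
  "below_with A i S = card {x \<in> A. i \<in> x \<and> x \<subseteq> insert i S}"

lemma below_nonneg [simp]: "0 \<le> below A W"
  by (simp add: below_def)

lemma below_with_nonneg [simp]: "0 \<le> below_with A i S"
  by (simp add: below_with_def)

lemma below_insert:
  assumes "finite A" "i \<notin> S"
  shows "below A (insert i S) = below A S + below_with A i S"
proof -
  have "{x \<in> A. x \<subseteq> insert i S} = {x \<in> A. x \<subseteq> S} \<union> {x \<in> A. i \<in> x \<and> x \<subseteq> insert i S}"
    by auto
  moreover have "card \<dots> = card {x \<in> A. x \<subseteq> S} + card {x \<in> A. i \<in> x \<and> x \<subseteq> insert i S}"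
    using assms by (intro card_Un_disjoint) auto
  ultimately show ?thesis
    by (simp add: below_def below_with_def)
qed

lemma below_le:
  assumes "finite W"
  shows "below A W \<le> 2 ^ card W"
proof -
  have "card {x \<in> A. x \<subseteq> W} \<le> card (Pow W)"
    using assms by (intro card_mono) auto
  then show ?thesis
    using assms by (simp add: below_def card_Pow)
qed

text \<open>Among the members of \<open>A\<close> below \<open>insert i S\<close>, the two counts
  compared are those containing \<open>i\<close> and those avoiding it, so this is a strict form of
  the bias hypothesis of \<open>card_family_le_of_biased\<close> for the coordinate
  \<open>i\<close>.\<close>

definition unbalanced :: "real \<Rightarrow> 'a set set \<Rightarrow> 'a \<Rightarrow> 'a set \<Rightarrow> bool" where
  "unbalanced \<eta> A i S \<longleftrightarrow> \<eta> * below A (insert i S) < \<bar>below_with A i S - below A S\<bar>"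

text \<open>After regrouping by \<open>W\<close>, the number of unbalanced coordinates in
  \<open>W\<close> appears as a factor. If it is at most \<open>\<theta> * N\<close>, the first
  summand pays; otherwise \<open>card_family_le_of_biased\<close> makes \<open>below A W\<close>
  exponentially smaller than \<open>2 ^ card W\<close>, and the second summand pays.\<close>

lemma sum_unbalanced_le:
  fixes A B :: "'a set set" and U :: "'a set" and \<eta> \<theta> :: real
  defines "N \<equiv> real (card U)"
  assumes U: "finite U" and \<eta>: "0 < \<eta>" "\<eta> \<le> 1" and "0 \<le> \<theta>"
  shows "(\<Sum>i\<in>U. \<Sum>S\<in>Pow (U - {i}).
            of_bool (unbalanced \<eta> A i S) * (below A (insert i S) * below B (U - {i} - S)))
      \<le> \<theta> * N * (\<Sum>W\<in>Pow U. below A W * below B (U - W)) + N * 4 ^ card U * exp (- (\<eta>\<^sup>2 / 4 * \<theta> * N))"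
    (is "?L \<le> _")
proof -
  define E where "E = exp (- (\<eta>\<^sup>2 / 4 * \<theta> * N))"
  define J where "J W = {i \<in> W. unbalanced \<eta> A i (W - {i})}" for W
  have "?L = (\<Sum>W\<in>Pow U. \<Sum>i\<in>W. of_bool (unbalanced \<eta> A i (W - {i})) *
      (below A (insert i (W - {i})) * below B (U - {i} - (W - {i}))))"
    using U by (rule sum_remove_point_insert)
  also have "\<dots> = (\<Sum>W\<in>Pow U. card (J W) * (below A W * below B (U - W)))"
  proof (intro sum.cong refl)
    fix W assume W: "W \<in> Pow U"
    then have fin: "finite W" using U finite_subset by auto
    have "(\<Sum>i\<in>W. of_bool (unbalanced \<eta> A i (W - {i})) *
          (below A (insert i (W - {i})) * below B (U - {i} - (W - {i}))))
        = (\<Sum>i\<in>W. of_bool (i \<in> J W) * (below A W * below B (U - W)))"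
      using W by (intro sum.cong refl) (auto simp: J_def insert_absorb intro!: arg_cong2[where f="(*)"] arg_cong[where f="below B"])
    also have "\<dots> = card (J W) * (below A W * below B (U - W))"
      using fin by (simp add: J_def Int_def flip: sum_distrib_right)
    finally show "(\<Sum>i\<in>W. of_bool (unbalanced \<eta> A i (W - {i})) *
          (below A (insert i (W - {i})) * below B (U - {i} - (W - {i})))) = \<dots>" .
  qed
  also have "\<dots> \<le> (\<Sum>W\<in>Pow U. \<theta> * N * (below A W * below B (U - W)) + N * 2 ^ card U * E)"
  proof (intro sum_mono)
    fix W assume W: "W \<in> Pow U"
    then have fin: "finite W" using U finite_subset by auto
    have JW: "J W \<subseteq> W" by (auto simp: J_def)
    have "card (J W) \<le> card U" using JW W U by (intro card_mono) auto
    then have JN: "real (card (J W)) \<le> N" by (simp add: N_def)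
    show "card (J W) * (below A W * below B (U - W)) \<le> \<theta> * N * (below A W * below B (U - W)) + N * 2 ^ card U * E"
    proof (cases "card (J W) \<le> \<theta> * N")
      case True
      then show ?thesis
        by (intro add_increasing2 mult_right_mono) (auto simp: N_def E_def)
    next
      case False
      have "card {x \<in> A. x \<subseteq> W} * exp (\<eta>\<^sup>2 / 4 * card (J W)) \<le> 2 ^ card W"
      proof (rule card_family_le_of_biased[OF fin _ JW \<eta>])
        fix i assume i: "i \<in> J W"
        have "{x \<in> {x \<in> A. x \<subseteq> W}. i \<in> x} = {x \<in> A. i \<in> x \<and> x \<subseteq> insert i (W - {i})}"
          "{x \<in> {x \<in> A. x \<subseteq> W}. i \<notin> x} = {x \<in> A. x \<subseteq> W - {i}}"
          "insert i (W - {i}) = W"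
          using i JW by auto
        with i show "\<eta> * real (card {x \<in> A. x \<subseteq> W})
            \<le> \<bar>real (card {x \<in> {x \<in> A. x \<subseteq> W}. i \<in> x}) - real (card {x \<in> {x \<in> A. x \<subseteq> W}. i \<notin> x})\<bar>"
          by (simp add: J_def unbalanced_def below_def below_with_def)
      qed auto
      then have "below A W \<le> 2 ^ card W * exp (- (\<eta>\<^sup>2 / 4 * card (J W)))"
        by (simp add: below_def exp_minus field_simps)
      also have "\<dots> \<le> 2 ^ card W * E"
        using False \<eta> by (simp add: E_def mult.assoc mult_left_mono)
      finally have "below A W * below B (U - W) \<le> 2 ^ card W * E * 2 ^ card (U - W)"
        using U by (intro mult_mono below_le) (auto simp: E_def)
      also have "\<dots> = 2 ^ (card W + card (U - W)) * E"
        by (simp add: power_add)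
      also have "card W + card (U - W) = card U"
        using W U fin by (simp add: card_Diff_subset card_mono)
      finally have "below A W * below B (U - W) \<le> 2 ^ card U * E" .
      then have "card (J W) * (below A W * below B (U - W)) \<le> N * (2 ^ card U * E)"
        by (rule mult_mono[OF JN]) (auto simp: N_def)
      then show ?thesis
        using \<open>0 \<le> \<theta>\<close> by (intro add_increasing) (auto simp: N_def mult_ac)
    qed
  qed
  also have "\<dots> = \<theta> * N * (\<Sum>W\<in>Pow U. below A W * below B (U - W)) + N * 4 ^ card U * E"
    using U by (simp add: sum.distrib card_Pow sum_distrib_left mult_ac flip: power_mult_distrib)
  finally show ?thesis
    by (simp add: E_def)
qed

section \<open>Corruption of a single rectangle\<close>

lemma balanced_ratio:
  assumes "finite A" "i \<notin> S" "0 < \<eta>" "\<eta> < 1" "\<not> unbalanced \<eta> A i S"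
  shows "below A S \<le> (1 + \<eta>) / (1 - \<eta>) * below_with A i S"
    "below_with A i S \<le> (1 + \<eta>) / (1 - \<eta>) * below A S"
  using assms by (auto simp: unbalanced_def below_insert field_simps)

lemma sum_pairs: "(\<Sum>x\<in>A. \<Sum>y\<in>B. g x y) = (\<Sum>p\<in>A \<times> B. g (fst p) (snd p))"
  by (simp add: sum.cartesian_product split_beta)

lemma sum_of_bool_mult:
  assumes "finite A" "finite B"
  shows "(\<Sum>x\<in>A. \<Sum>y\<in>B. of_bool (P x) * of_bool (Q y))
    = (real (card {x \<in> A. P x}) * real (card {y \<in> B. Q y}))"
proof -
  have "(\<Sum>x\<in>A. \<Sum>y\<in>B. of_bool (P x) * of_bool (Q y))
      = (\<Sum>x\<in>A. of_bool (P x)) * (\<Sum>y\<in>B. of_bool (Q y) :: real)"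
    by (simp only: sum_product)
  then show ?thesis
    using assms by (simp add: Int_def)
qed

text \<open>Divided by \<open>4 ^ card U\<close>, \<open>disjoint_weight U x y\<close> is the probability of \<open>(x, y)\<close> when a
  random set \<open>W\<close> splits \<open>U\<close> between the players and each of them picks a random subset of their
  part.  In \<open>meeting_weight\<close> a random element \<open>i\<close> is given to both players, who must pick it; the
  normalisation is \<open>card U * 4 ^ (card U - 1)\<close>.\<close>

definition disjoint_weight :: "'a set \<Rightarrow> 'a set \<Rightarrow> 'a set \<Rightarrow> real" where
  "disjoint_weight U x y = (\<Sum>W\<in>Pow U. of_bool (x \<subseteq> W) * of_bool (y \<subseteq> U - W))"

definition meeting_weight :: "'a set \<Rightarrow> 'a set \<Rightarrow> 'a set \<Rightarrow> real" where
  "meeting_weight U x y = (\<Sum>i\<in>U. \<Sum>S\<in>Pow (U - {i}).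
     of_bool (i \<in> x \<and> x \<subseteq> insert i S) * of_bool (i \<in> y \<and> y \<subseteq> insert i (U - {i} - S)))"

lemma sum_disjoint_weight:
  assumes "finite A" "finite B"
  shows "(\<Sum>x\<in>A. \<Sum>y\<in>B. disjoint_weight U x y) = (\<Sum>W\<in>Pow U. below A W * below B (U - W))"
proof -
  have "(\<Sum>x\<in>A. \<Sum>y\<in>B. disjoint_weight U x y)
      = (\<Sum>W\<in>Pow U. \<Sum>x\<in>A. \<Sum>y\<in>B. of_bool (x \<subseteq> W) * of_bool (y \<subseteq> U - W))"
    (is "_ = (\<Sum>W\<in>Pow U. \<Sum>x\<in>A. \<Sum>y\<in>B. ?f x y W)")
  proof -
    have "(\<Sum>x\<in>A. \<Sum>y\<in>B. disjoint_weight U x y) = (\<Sum>p\<in>A \<times> B. \<Sum>W\<in>Pow U. ?f (fst p) (snd p) W)"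
      unfolding disjoint_weight_def by (rule sum_pairs)
    also have "\<dots> = (\<Sum>W\<in>Pow U. \<Sum>p\<in>A \<times> B. ?f (fst p) (snd p) W)"
      by (rule sum.swap)
    also have "\<dots> = (\<Sum>W\<in>Pow U. \<Sum>x\<in>A. \<Sum>y\<in>B. ?f x y W)"
      by (intro sum.cong refl sum_pairs[symmetric])
    finally show ?thesis .
  qed
  also have "\<dots> = (\<Sum>W\<in>Pow U. below A W * below B (U - W))"
    using assms by (simp only: below_def sum_of_bool_mult)
  finally show ?thesis .
qed

lemma sum_meeting_weight:
  assumes "finite A" "finite B"
  shows "(\<Sum>x\<in>A. \<Sum>y\<in>B. meeting_weight U x y)
    = (\<Sum>i\<in>U. \<Sum>S\<in>Pow (U - {i}). below_with A i S * below_with B i (U - {i} - S))"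
proof -
  have "(\<Sum>x\<in>A. \<Sum>y\<in>B. meeting_weight U x y)
      = (\<Sum>i\<in>U. \<Sum>S\<in>Pow (U - {i}). \<Sum>x\<in>A. \<Sum>y\<in>B.
          of_bool (i \<in> x \<and> x \<subseteq> insert i S) * of_bool (i \<in> y \<and> y \<subseteq> insert i (U - {i} - S)))"
    (is "_ = (\<Sum>i\<in>U. \<Sum>S\<in>Pow (U - {i}). \<Sum>x\<in>A. \<Sum>y\<in>B. ?f x y i S)")
  proof -
    have "(\<Sum>x\<in>A. \<Sum>y\<in>B. meeting_weight U x y)
        = (\<Sum>p\<in>A \<times> B. \<Sum>i\<in>U. \<Sum>S\<in>Pow (U - {i}). ?f (fst p) (snd p) i S)"
      unfolding meeting_weight_def by (rule sum_pairs)
    also have "\<dots> = (\<Sum>i\<in>U. \<Sum>p\<in>A \<times> B. \<Sum>S\<in>Pow (U - {i}). ?f (fst p) (snd p) i S)"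
      by (rule sum.swap)
    also have "\<dots> = (\<Sum>i\<in>U. \<Sum>S\<in>Pow (U - {i}). \<Sum>p\<in>A \<times> B. ?f (fst p) (snd p) i S)"
      by (intro sum.cong refl sum.swap)
    also have "\<dots> = (\<Sum>i\<in>U. \<Sum>S\<in>Pow (U - {i}). \<Sum>x\<in>A. \<Sum>y\<in>B. ?f x y i S)"
      by (intro sum.cong refl sum_pairs[symmetric])
    finally show ?thesis .
  qed
  also have "\<dots> = (\<Sum>i\<in>U. \<Sum>S\<in>Pow (U - {i}). below_with A i S * below_with B i (U - {i} - S))"
    using assms by (simp only: below_with_def sum_of_bool_mult)
  finally show ?thesis .
qed

text \<open>\<open>p0\<close>, \<open>p1\<close> and \<open>q0\<close>, \<open>q1\<close> count the
  two players' sets without and with a marked point; the left side gives this point to the first or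
  to the second player. If both sides are balanced, every term is comparable to
  \<open>p1 * q1\<close>. Otherwise an unbalanced side pays, after a balanced one has absorbed its
  own mixed term.\<close>

lemma pointwise_corruption:
  fixes p0 p1 q0 q1 \<rho> :: real
  assumes nonneg: "0 \<le> p0" "0 \<le> p1" "0 \<le> q0" "0 \<le> q1" and \<rho>: "1 \<le> \<rho>" "\<rho> \<le> 2"
    and a: "\<not> a \<Longrightarrow> p0 \<le> \<rho> * p1 \<and> p1 \<le> \<rho> * p0"
    and b: "\<not> b \<Longrightarrow> q0 \<le> \<rho> * q1 \<and> q1 \<le> \<rho> * q0"
  shows "(p0 + p1) * q0 + p0 * (q0 + q1)
    \<le> 4 * \<rho>\<^sup>2 * (p1 * q1) + 4 * (of_bool a * ((p0 + p1) * q0)) + 4 * (of_bool b * ((q0 + q1) * p0))"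
proof -
  have pos: "0 \<le> p1 * q1" "0 \<le> p0 * q0" "0 \<le> p0 * q1" "0 \<le> p1 * q0" "0 \<le> \<rho>\<^sup>2 * (p1 * q1)"
    using nonneg by auto
  have from_a: "p1 * q0 \<le> 2 * (p0 * q0)" if "\<not> a"
  proof -
    have "p1 \<le> 2 * p0" using a[OF that] mult_right_mono[OF \<rho>(2) nonneg(1)] by linarith
    then show ?thesis using mult_right_mono[OF _ nonneg(3), of p1 "2 * p0"] by simp
  qed
  have from_b: "p0 * q1 \<le> 2 * (p0 * q0)" if "\<not> b"
  proof -
    have "q1 \<le> 2 * q0" using b[OF that] mult_right_mono[OF \<rho>(2) nonneg(3)] by linarith
    then show ?thesis using mult_left_mono[OF _ nonneg(1), of q1 "2 * q0"] by (simp add: mult_ac)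
  qed
  show ?thesis
  proof (cases a; cases b)
    assume "\<not> a" "\<not> b"
    have sq: "\<rho> * (p1 * q1) \<le> \<rho>\<^sup>2 * (p1 * q1)"
      using pos \<rho> by (intro mult_right_mono) (auto simp: power2_eq_square)
    have "p0 * q0 \<le> (\<rho> * p1) * (\<rho> * q1)"
      using a[OF \<open>\<not> a\<close>] b[OF \<open>\<not> b\<close>] nonneg \<rho> by (intro mult_mono) auto
    moreover have "p1 * q0 \<le> p1 * (\<rho> * q1)"
      using b[OF \<open>\<not> b\<close>] nonneg by (intro mult_left_mono) auto
    moreover have "p0 * q1 \<le> (\<rho> * p1) * q1"
      using a[OF \<open>\<not> a\<close>] nonneg by (intro mult_right_mono) auto
    ultimately show ?thesis
      using sq \<open>\<not> a\<close> \<open>\<not> b\<close> by (simp add: algebra_simps power2_eq_square)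
  qed (use pos from_a from_b in \<open>auto simp: algebra_simps\<close>)
qed

text \<open>Every point of \<open>U\<close> is marked in turn, on whichever side of the split it
  lies. \<open>pointwise_corruption\<close> compares this with giving the point to both players, and
  \<open>sum_unbalanced_le\<close> bounds the loss for each player; the two losses, each with factor
  \<open>4\<close>, make up the \<open>8\<close>.\<close>

lemma rectangle_corruption:
  fixes A B :: "'a set set" and U :: "'a set" and \<eta> \<theta> :: real
  defines "N \<equiv> real (card U)" and "\<rho> \<equiv> (1 + \<eta>) / (1 - \<eta>)"
  assumes U: "finite U" and AB: "finite A" "finite B"
    and \<eta>: "0 < \<eta>" "\<eta> \<le> 1 / 3" and "0 \<le> \<theta>"
  shows "(1 - 8 * \<theta>) * N * (\<Sum>x\<in>A. \<Sum>y\<in>B. disjoint_weight U x y)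
    \<le> 4 * \<rho>\<^sup>2 * (\<Sum>x\<in>A. \<Sum>y\<in>B. meeting_weight U x y)
      + 8 * N * 4 ^ card U * exp (- (\<eta>\<^sup>2 / 4 * \<theta> * N))"
proof -
  define D where "D = (\<Sum>W\<in>Pow U. below A W * below B (U - W))"
  define E where "E = exp (- (\<eta>\<^sup>2 / 4 * \<theta> * N))"
  define X where "X = (\<Sum>i\<in>U. \<Sum>S\<in>Pow (U - {i}).
      of_bool (unbalanced \<eta> A i S) * (below A (insert i S) * below B (U - {i} - S)))"
  define Y where "Y = (\<Sum>i\<in>U. \<Sum>S\<in>Pow (U - {i}).
      of_bool (unbalanced \<eta> B i S) * (below B (insert i S) * below A (U - {i} - S)))"
  let ?M = "\<Sum>i\<in>U. \<Sum>S\<in>Pow (U - {i}). below_with A i S * below_with B i (U - {i} - S)"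
  have \<rho>: "1 \<le> \<rho>" "\<rho> \<le> 2"
    using \<eta> by (auto simp: \<rho>_def field_simps)
  \<comment> \<open>Complementation exchanges the roles of the players, so that
    \<open>sum_unbalanced_le\<close> serves both.\<close>
  have D_swap: "(\<Sum>W\<in>Pow U. below B W * below A (U - W)) = D"
  proof -
    have "D = (\<Sum>W\<in>Pow U. below A (U - W) * below B (U - (U - W)))"
      unfolding D_def by (rule sum_Pow_complement[symmetric])
    also have "\<dots> = (\<Sum>W\<in>Pow U. below B W * below A (U - W))"
      by (intro sum.cong refl) (auto simp: double_diff)
    finally show ?thesis ..
  qed
  have "N * D = (\<Sum>W\<in>Pow U. N * (below A W * below B (U - W)))"
    by (simp add: D_def sum_distrib_left)
  also have "\<dots> = (\<Sum>W\<in>Pow U. (\<Sum>i\<in>W. below A W * below B (U - W)) + (\<Sum>i\<in>U - W. below A W * below B (U - W)))"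
  proof (intro sum.cong refl)
    fix W assume "W \<in> Pow U"
    then have "card W + card (U - W) = card U"
      using U by (simp add: card_Diff_subset card_mono finite_subset)
    then show "N * (below A W * below B (U - W))
        = (\<Sum>i\<in>W. below A W * below B (U - W)) + (\<Sum>i\<in>U - W. below A W * below B (U - W))"
      by (simp add: N_def flip: distrib_right of_nat_add)
  qed
  also have "\<dots> = (\<Sum>W\<in>Pow U. \<Sum>i\<in>W. below A (insert i (W - {i})) * below B (U - {i} - (W - {i})))
      + (\<Sum>W\<in>Pow U. \<Sum>i\<in>U - W. below A W * below B (insert i (U - {i} - W)))"
    unfolding sum.distrib
    by (intro arg_cong2[where f = "(+)"] sum.cong refl arg_cong2[where f = "(*)"]
        arg_cong[where f = "below A"] arg_cong[where f = "below B"]) auto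
  also have "\<dots> = (\<Sum>i\<in>U. \<Sum>S\<in>Pow (U - {i}).
      below A (insert i S) * below B (U - {i} - S) + below A S * below B (insert i (U - {i} - S)))"
    unfolding sum.distrib using U
    by (intro arg_cong2[where f = "(+)"] sum_remove_point_insert[symmetric] sum_remove_point_swap[symmetric])
  also have "\<dots> \<le> (\<Sum>i\<in>U. \<Sum>S\<in>Pow (U - {i}).
      4 * \<rho>\<^sup>2 * (below_with A i S * below_with B i (U - {i} - S))
      + 4 * (of_bool (unbalanced \<eta> A i S) * (below A (insert i S) * below B (U - {i} - S)))
      + 4 * (of_bool (unbalanced \<eta> B i (U - {i} - S)) * (below B (insert i (U - {i} - S)) * below A S)))"
  proof (intro sum_mono)
    fix i S assume i: "i \<in> U" and "S \<in> Pow (U - {i})"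
    then have notin: "i \<notin> S" "i \<notin> U - {i} - S" by auto
    have \<eta>': "\<eta> < 1" using \<eta> by simp
    show "below A (insert i S) * below B (U - {i} - S) + below A S * below B (insert i (U - {i} - S))
      \<le> 4 * \<rho>\<^sup>2 * (below_with A i S * below_with B i (U - {i} - S))
      + 4 * (of_bool (unbalanced \<eta> A i S) * (below A (insert i S) * below B (U - {i} - S)))
      + 4 * (of_bool (unbalanced \<eta> B i (U - {i} - S)) * (below B (insert i (U - {i} - S)) * below A S))"
      unfolding below_insert[OF AB(1) notin(1)] below_insert[OF AB(2) notin(2)]
      using balanced_ratio[OF AB(1) notin(1) \<eta>(1) \<eta>'] balanced_ratio[OF AB(2) notin(2) \<eta>(1) \<eta>'] \<rho>
      by (intro pointwise_corruption) (auto simp: \<rho>_def)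
  qed
  also have "\<dots> = 4 * \<rho>\<^sup>2 * ?M + 4 * X + 4 * (\<Sum>i\<in>U. \<Sum>S\<in>Pow (U - {i}).
      of_bool (unbalanced \<eta> B i (U - {i} - S)) * (below B (insert i (U - {i} - S)) * below A S))"
    by (simp only: X_def sum.distrib sum_distrib_left)
  \<comment> \<open>Replacing \<open>S\<close> by its complement in \<open>U - {i}\<close> brings
    the second player's loss into the form of \<open>sum_unbalanced_le\<close>.\<close>
  also have "(\<Sum>i\<in>U. \<Sum>S\<in>Pow (U - {i}).
      of_bool (unbalanced \<eta> B i (U - {i} - S)) * (below B (insert i (U - {i} - S)) * below A S)) = Y"
    unfolding Y_def
  proof (rule sum.cong[OF refl])
    fix i
    have "(\<Sum>S\<in>Pow (U - {i}). of_bool (unbalanced \<eta> B i (U - {i} - S)) * (below B (insert i (U - {i} - S)) * below A S))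
      = (\<Sum>S\<in>Pow (U - {i}). of_bool (unbalanced \<eta> B i (U - {i} - S)) *
          (below B (insert i (U - {i} - S)) * below A (U - {i} - (U - {i} - S))))"
      by (intro sum.cong refl) (auto simp: double_diff)
    also have "\<dots> = (\<Sum>S\<in>Pow (U - {i}). of_bool (unbalanced \<eta> B i S) * (below B (insert i S) * below A (U - {i} - S)))"
      by (rule sum_Pow_complement)
    finally show "(\<Sum>S\<in>Pow (U - {i}). of_bool (unbalanced \<eta> B i (U - {i} - S)) * (below B (insert i (U - {i} - S)) * below A S)) = \<dots>" .
  qed
  finally have "N * D \<le> 4 * \<rho>\<^sup>2 * ?M + 4 * X + 4 * Y" .
  moreover have "X \<le> \<theta> * N * D + N * 4 ^ card U * E"
    unfolding X_def D_def E_def N_def using U \<eta> \<open>0 \<le> \<theta>\<close> by (intro sum_unbalanced_le) auto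
  moreover have "Y \<le> \<theta> * N * D + N * 4 ^ card U * E"
    unfolding Y_def D_swap[symmetric] E_def N_def using U \<eta> \<open>0 \<le> \<theta>\<close> by (intro sum_unbalanced_le) auto
  ultimately have "(1 - 8 * \<theta>) * N * D \<le> 4 * \<rho>\<^sup>2 * ?M + 8 * N * 4 ^ card U * E"
    by (simp add: algebra_simps)
  then show ?thesis
    by (simp only: sum_disjoint_weight[OF AB] sum_meeting_weight[OF AB] D_def E_def)
qed

section \<open>From rectangles to randomised protocols\<close>

lemma sum_disjoint_weight_Pow:
  assumes U: "finite U"
  shows "(\<Sum>x\<in>Pow U. \<Sum>y\<in>Pow U. disjoint_weight U x y) = 4 ^ card U"
proof -
  have "(\<Sum>W\<in>Pow U. below (Pow U) W * below (Pow U) (U - W)) = (\<Sum>W\<in>Pow U. 2 ^ card U)"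
  proof (intro sum.cong refl)
    fix W assume W: "W \<in> Pow U"
    then have "{x \<in> Pow U. x \<subseteq> W} = Pow W" "{x \<in> Pow U. x \<subseteq> U - W} = Pow (U - W)" by auto
    moreover have "card W + card (U - W) = card U" "finite W"
      using U W by (auto simp: card_Diff_subset card_mono finite_subset)
    ultimately show "below (Pow U) W * below (Pow U) (U - W) = 2 ^ card U"
      using U by (simp add: below_def card_Pow flip: power_add)
  qed
  then show ?thesis
    using U by (simp add: sum_disjoint_weight card_Pow flip: power_mult_distrib)
qed

text \<open>There are \<open>card U\<close> points, \<open>2 ^ (card U - 1)\<close> splits of the
  rest and as many pairs of sets per split; the factor \<open>4\<close> clears the exponent
  \<open>card U - 1\<close>.\<close>

lemma sum_meeting_weight_Pow:
  assumes U: "finite U"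
  shows "4 * (\<Sum>x\<in>Pow U. \<Sum>y\<in>Pow U. meeting_weight U x y) = card U * 4 ^ card U"
proof -
  have below_with_Pow: "below_with (Pow U) i S = 2 ^ card S" if "i \<in> U" "S \<subseteq> U - {i}" for i S
  proof -
    have "{x \<in> Pow U. i \<in> x \<and> x \<subseteq> insert i S} = insert i ` Pow S"
    proof (intro set_eqI iffI)
      fix x assume "x \<in> {x \<in> Pow U. i \<in> x \<and> x \<subseteq> insert i S}"
      then have "x = insert i (x - {i})" "x - {i} \<in> Pow S" by auto
      then show "x \<in> insert i ` Pow S" by blast
    qed (use that in auto)
    moreover have "inj_on (insert i) (Pow S)"
      using that by (auto simp: inj_on_def)
    moreover have "finite S" using U that finite_subset by blast
    ultimately show ?thesis
      by (simp add: below_with_def card_image card_Pow)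
  qed
  have "4 * (\<Sum>i\<in>U. \<Sum>S\<in>Pow (U - {i}). below_with (Pow U) i S * below_with (Pow U) i (U - {i} - S))
      = (\<Sum>i\<in>U. 4 * (\<Sum>S\<in>Pow (U - {i}). 2 ^ card (U - {i})))"
    unfolding sum_distrib_left[of 4]
  proof (intro sum.cong refl)
    fix i S assume i: "i \<in> U" and S: "S \<in> Pow (U - {i})"
    then have "card S + card (U - {i} - S) = card (U - {i})"
      using U by (metis PowD card_Diff_subset card_mono finite_Diff finite_subset le_add_diff_inverse)
    then show "4 * (below_with (Pow U) i S * below_with (Pow U) i (U - {i} - S)) = 4 * 2 ^ card (U - {i})"
      using i S by (subst (1 2) below_with_Pow) (auto simp flip: power_add)
  qed
  also have "\<dots> = (\<Sum>i\<in>U. 4 ^ card U)"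
  proof (intro sum.cong refl)
    fix i assume i: "i \<in> U"
    have "4 * (\<Sum>S\<in>Pow (U - {i}). 2 ^ card (U - {i}) :: real) = 2 ^ Suc (card (U - {i})) * 2 ^ Suc (card (U - {i}))"
      using U by (simp add: card_Pow)
    also have "Suc (card (U - {i})) = card U"
      using U i by (metis card_Suc_Diff1)
    finally show "4 * (\<Sum>S\<in>Pow (U - {i}). 2 ^ card (U - {i}) :: real) = 4 ^ card U"
      by (simp flip: power_mult_distrib)
  qed
  finally show ?thesis
    using U by (simp add: sum_meeting_weight)
qed

text \<open>Averaging, as in the easy direction of Yao's principle: random coins are replaced by one
  fixed outcome that does as well on a weighted family of inputs.\<close>

lemma exists_outcome_sum_ge:
  fixes \<kappa> :: "'i \<Rightarrow> real" and S :: "'i \<Rightarrow> 'c set"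
  assumes M: "prob_space M" and I: "finite I" and \<kappa>: "\<And>i. i \<in> I \<Longrightarrow> 0 \<le> \<kappa> i"
    and S: "\<And>i. i \<in> I \<Longrightarrow> S i \<in> sets M" "\<And>i. i \<in> I \<Longrightarrow> p \<le> measure M (S i)"
  shows "\<exists>c\<in>space M. p * (\<Sum>i\<in>I. \<kappa> i) \<le> (\<Sum>i\<in>I. \<kappa> i * indicator (S i) c)"
proof (rule ccontr)
  interpret prob_space M by fact
  assume "\<not> ?thesis"
  then have less: "(\<Sum>i\<in>I. \<kappa> i * indicator (S i) c) < p * (\<Sum>i\<in>I. \<kappa> i)" if "c \<in> space M" for c
    using that by (auto simp: not_le)
  have int: "integrable M (\<lambda>c. \<kappa> i * indicator (S i) c)" if "i \<in> I" for i
    using S(1)[OF that] by (intro integrable_mult_right integrable_real_indicator) (auto simp: emeasure_finite less_top[symmetric])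
  have "expectation (\<lambda>c. \<Sum>i\<in>I. \<kappa> i * indicator (S i) c) < p * (\<Sum>i\<in>I. \<kappa> i)"
    using int less by (intro expectation_less) auto
  also have "\<dots> \<le> (\<Sum>i\<in>I. \<kappa> i * measure M (S i))"
    unfolding sum_distrib_left using \<kappa> S(2)
    by (intro sum_mono) (metis mult.commute mult_left_mono)
  also have "\<dots> = expectation (\<lambda>c. \<Sum>i\<in>I. \<kappa> i * indicator (S i) c)"
    using int S(1) by (simp add: Bochner_Integration.integral_sum)
  finally show False by simp
qed

text \<open>Two features of a protocol enter: few transcripts, and that accepted inputs with equal
  transcripts form a rectangle. With the coins fixed, \<open>rectangle_corruption\<close> bounds the
  accepted disjoint weight by the accepted meeting weight, up to an exponentially small error per
  transcript. Hence no outcome scores much more than \<open>\<rho>\<^sup>2\<close> out of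
  \<open>1 - 8 * \<eta> + \<rho>\<^sup>2\<close>.\<close>

lemma disjointness_transcripts:
  fixes U :: "'a set" and M :: "'c measure" and S :: "'a set \<Rightarrow> 'a set \<Rightarrow> 'c set"
    and acc :: "'c \<Rightarrow> 'a set \<Rightarrow> 'a set \<Rightarrow> bool" and tr :: "'c \<Rightarrow> 'a set \<Rightarrow> 'a set \<Rightarrow> 't"
    and \<epsilon> \<eta> :: real
  defines "\<rho> \<equiv> (1 + \<eta>) / (1 - \<eta>)"
  assumes U: "finite U" "U \<noteq> {}" and M: "prob_space M" and \<epsilon>: "\<epsilon> < 1" and \<eta>: "0 < \<eta>" "\<eta> \<le> 1 / 8"
    and prob: "\<And>x y. x \<subseteq> U \<Longrightarrow> y \<subseteq> U \<Longrightarrow> 1 - \<epsilon> \<le> measure M (S x y)"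
    and correct: "\<And>c x y. \<lbrakk>c \<in> space M; x \<subseteq> U; y \<subseteq> U; c \<in> S x y\<rbrakk> \<Longrightarrow> acc c x y \<longleftrightarrow> x \<inter> y = {}"
    and \<Gamma>: "finite \<Gamma>" "\<And>c x y. \<lbrakk>c \<in> space M; x \<subseteq> U; y \<subseteq> U\<rbrakk> \<Longrightarrow> tr c x y \<in> \<Gamma>"
    and rectangle: "\<And>c x y x' y'. \<lbrakk>c \<in> space M; x \<subseteq> U; y \<subseteq> U; x' \<subseteq> U; y' \<subseteq> U; acc c x y; acc c x' y';
        tr c x y = tr c x' y'\<rbrakk> \<Longrightarrow> acc c x y' \<and> tr c x y' = tr c x y"
  shows "(1 - \<epsilon>) * (1 - 8 * \<eta>) - \<epsilon> * \<rho>\<^sup>2 \<le> 8 * card \<Gamma> * exp (- (\<eta> ^ 3 / 4 * card U))"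
proof -
  define N where "N = real (card U)"
  define E where "E = exp (- (\<eta> ^ 3 / 4 * N))"
  define Q where "Q = Pow U \<times> Pow U"
  define d where "d p = disjoint_weight U (fst p) (snd p)" for p
  define m where "m p = meeting_weight U (fst p) (snd p)" for p
  have N: "0 < N" using U by (simp add: N_def card_gt_0_iff)
  have fin: "finite Q" "finite (Pow U)" using U by (auto simp: Q_def)
  have d0: "0 \<le> d p" and m0: "0 \<le> m p" for p
    by (auto simp: d_def m_def disjoint_weight_def meeting_weight_def intro!: sum_nonneg)
  have dQ: "sum d Q = 4 ^ card U"
    using sum_disjoint_weight_Pow[OF U(1)] by (simp add: d_def Q_def sum_pairs)
  have mQ: "4 * sum m Q = N * 4 ^ card U"
    using sum_meeting_weight_Pow[OF U(1)] by (simp add: m_def Q_def N_def sum_pairs)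
  \<comment> \<open>The coefficients are those of \<open>rectangle_corruption\<close> with
    \<open>\<theta> = \<eta>\<close>, so that the meeting weight of the accepted inputs cancels in
    the end.\<close>
  define \<kappa> where "\<kappa> p = (1 - 8 * \<eta>) * N * d p + 4 * \<rho>\<^sup>2 * m p" for p
  have \<kappa>0: "0 \<le> \<kappa> p" for p
    using d0 m0 \<eta> N by (simp add: \<kappa>_def)
  have \<kappa>Q: "sum \<kappa> Q = (1 - 8 * \<eta> + \<rho>\<^sup>2) * (N * 4 ^ card U)"
  proof -
    have "sum \<kappa> Q = (1 - 8 * \<eta>) * N * sum d Q + \<rho>\<^sup>2 * (4 * sum m Q)"
      by (simp add: \<kappa>_def sum.distrib flip: sum_distrib_left)
    then show ?thesis unfolding dQ mQ by (simp add: algebra_simps)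
  qed
  have "\<exists>c\<in>space M. (1 - \<epsilon>) * sum \<kappa> Q \<le> (\<Sum>p\<in>Q. \<kappa> p * indicator (S (fst p) (snd p)) c)"
  proof (rule exists_outcome_sum_ge[OF M fin(1) \<kappa>0])
    fix p assume "p \<in> Q"
    then have p: "1 - \<epsilon> \<le> measure M (S (fst p) (snd p))"
      using prob by (auto simp: Q_def)
    then show "1 - \<epsilon> \<le> measure M (S (fst p) (snd p))" .
    \<comment> \<open>A non-measurable set has measure \<open>0\<close>, which is below
      \<open>1 - \<epsilon>\<close>.\<close>
    show "S (fst p) (snd p) \<in> sets M"
      using p \<epsilon> measure_notin_sets[of "S (fst p) (snd p)" M] by fastforce
  qed
  then obtain c where c: "c \<in> space M"
    and "(1 - \<epsilon>) * sum \<kappa> Q \<le> (\<Sum>p\<in>Q. \<kappa> p * indicator (S (fst p) (snd p)) c)" by auto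
  note this(2)
  also define Acc where "Acc = {p \<in> Q. acc c (fst p) (snd p)}"
  have "(\<Sum>p\<in>Q. \<kappa> p * indicator (S (fst p) (snd p)) c)
      \<le> (\<Sum>p\<in>Q. (1 - 8 * \<eta>) * N * (of_bool (p \<in> Acc) * d p) + 4 * \<rho>\<^sup>2 * (m p - of_bool (p \<in> Acc) * m p))"
  proof (intro sum_mono)
    fix p assume p: "p \<in> Q"
    show "\<kappa> p * indicator (S (fst p) (snd p)) c
      \<le> (1 - 8 * \<eta>) * N * (of_bool (p \<in> Acc) * d p) + 4 * \<rho>\<^sup>2 * (m p - of_bool (p \<in> Acc) * m p)"
    \<comment> \<open>On success an accepted input is disjoint and has no meeting weight, and a
      rejected one meets and has no disjoint weight; on failure the left side is
      \<open>0\<close>.\<close>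
    proof (cases "c \<in> S (fst p) (snd p)")
      case True
      then have iff: "p \<in> Acc \<longleftrightarrow> fst p \<inter> snd p = {}"
        using p c correct by (auto simp: Acc_def Q_def)
      have "m p = 0" if "fst p \<inter> snd p = {}"
        using that by (auto simp: m_def meeting_weight_def intro!: sum.neutral)
      moreover have "d p = 0" if "fst p \<inter> snd p \<noteq> {}"
        using that unfolding d_def disjoint_weight_def by (intro sum.neutral ballI) (simp, blast)
      ultimately show ?thesis
        using iff True by (auto simp: \<kappa>_def)
    next
      case False
      then show ?thesis
        using d0[of p] m0[of p] \<eta> N by auto
    qed
  qed
  also have "\<dots> = (1 - 8 * \<eta>) * N * sum d Acc + 4 * \<rho>\<^sup>2 * (sum m Q - sum m Acc)"
  proof -
    have Acc: "(\<Sum>p\<in>Q. of_bool (p \<in> Acc) * f p) = sum f Acc" for f :: "_ \<Rightarrow> real"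
      using fin by (intro sum.mono_neutral_cong_right) (auto simp: Acc_def)
    show ?thesis
      by (simp only: sum.distrib sum_subtractf Acc flip: sum_distrib_left)
  qed
  also have "(1 - 8 * \<eta>) * N * sum d Acc \<le> 4 * \<rho>\<^sup>2 * sum m Acc + card \<Gamma> * (8 * N * 4 ^ card U * E)"
  proof -
    define P where "P \<tau> = {p \<in> Acc. tr c (fst p) (snd p) = \<tau>}" for \<tau>
    have group: "(\<Sum>\<tau>\<in>\<Gamma>. sum f (P \<tau>)) = sum f Acc" for f :: "_ \<Rightarrow> real"
      unfolding P_def using fin \<Gamma> c by (intro sum.group) (auto simp: Acc_def Q_def)
    have P_le: "(1 - 8 * \<eta>) * N * sum d (P \<tau>) \<le> 4 * \<rho>\<^sup>2 * sum m (P \<tau>) + 8 * N * 4 ^ card U * E" for \<tau>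
    proof -
      have P_sub: "P \<tau> \<subseteq> Q" by (auto simp: P_def Acc_def)
      have "P \<tau> = fst ` P \<tau> \<times> snd ` P \<tau>"
      proof (intro set_eqI iffI)
        fix p assume "p \<in> fst ` P \<tau> \<times> snd ` P \<tau>"
        then obtain p1 p2 where p: "p1 \<in> P \<tau>" "p2 \<in> P \<tau>" "p = (fst p1, snd p2)"
          by (cases p) auto
        then have "acc c (fst p1) (snd p2) \<and> tr c (fst p1) (snd p2) = tr c (fst p1) (snd p1)"
          by (intro rectangle[OF c, of _ _ "fst p2"]) (auto simp: P_def Acc_def Q_def)
        then show "p \<in> P \<tau>"
          using p by (auto simp: P_def Acc_def Q_def)
      qed force
      then have sums: "sum f (P \<tau>) = (\<Sum>x\<in>fst ` P \<tau>. \<Sum>y\<in>snd ` P \<tau>. f (x, y))" for f :: "_ \<Rightarrow> real"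
        by (simp only: sum.cartesian_product case_prod_eta)
      have "finite (P \<tau>)" using P_sub fin finite_subset by blast
      then show ?thesis
        using rectangle_corruption[OF U(1), of "fst ` P \<tau>" "snd ` P \<tau>" \<eta> \<eta>] \<eta>
        by (simp add: sums d_def m_def N_def \<rho>_def E_def power3_eq_cube power2_eq_square)
    qed
    have "(1 - 8 * \<eta>) * N * sum d Acc = (\<Sum>\<tau>\<in>\<Gamma>. (1 - 8 * \<eta>) * N * sum d (P \<tau>))"
      by (simp add: group flip: sum_distrib_left)
    also have "\<dots> \<le> (\<Sum>\<tau>\<in>\<Gamma>. 4 * \<rho>\<^sup>2 * sum m (P \<tau>) + 8 * N * 4 ^ card U * E)"
      by (intro sum_mono P_le)
    also have "\<dots> = 4 * \<rho>\<^sup>2 * sum m Acc + card \<Gamma> * (8 * N * 4 ^ card U * E)"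
      by (simp add: sum.distrib group flip: sum_distrib_left)
    finally show ?thesis .
  qed
  finally have "(1 - \<epsilon>) * sum \<kappa> Q \<le> \<rho>\<^sup>2 * (4 * sum m Q) + card \<Gamma> * (8 * N * 4 ^ card U * E)"
    by (simp add: algebra_simps)
  then have "(N * 4 ^ card U) * ((1 - \<epsilon>) * (1 - 8 * \<eta> + \<rho>\<^sup>2)) \<le> (N * 4 ^ card U) * (\<rho>\<^sup>2 + 8 * card \<Gamma> * E)"
    unfolding \<kappa>Q mQ by (simp add: algebra_simps)
  then have "(1 - \<epsilon>) * (1 - 8 * \<eta> + \<rho>\<^sup>2) \<le> \<rho>\<^sup>2 + 8 * card \<Gamma> * E"
    using N by (subst (asm) mult_le_cancel_left_pos) auto
  then show ?thesis
    by (simp add: E_def N_def algebra_simps)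
qed

text \<open>At \<open>\<eta> = 0\<close> the expression is \<open>1 - 2 * \<epsilon>\<close>, which
  is positive, so continuity from the right suffices.\<close>

lemma disjointness_constant:
  fixes \<epsilon> :: real
  assumes "\<epsilon> < 1 / 2"
  obtains \<eta> :: real where "0 < \<eta>" "\<eta> \<le> 1 / 8" "0 < (1 - \<epsilon>) * (1 - 8 * \<eta>) - \<epsilon> * ((1 + \<eta>) / (1 - \<eta>))\<^sup>2"
proof -
  have "((\<lambda>\<eta>. (1 - \<epsilon>) * (1 - 8 * \<eta>) - \<epsilon> * ((1 + \<eta>) / (1 - \<eta>))\<^sup>2)
      \<longlongrightarrow> (1 - \<epsilon>) * (1 - 8 * 0) - \<epsilon> * ((1 + 0) / (1 - 0))\<^sup>2) (at_right (0 :: real))"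
    by (intro tendsto_intros) auto
  then have "\<forall>\<^sub>F \<eta> in at_right 0. 0 < (1 - \<epsilon>) * (1 - 8 * \<eta>) - \<epsilon> * ((1 + \<eta>) / (1 - \<eta>))\<^sup>2"
    using assms by (intro order_tendstoD) auto
  moreover have "\<forall>\<^sub>F \<eta> in at_right 0. \<eta> \<in> {0<..<1 / 8 :: real}"
    by (rule eventually_at_right_real) simp
  ultimately have "\<forall>\<^sub>F \<eta> in at_right 0. 0 < (1 - \<epsilon>) * (1 - 8 * \<eta>) - \<epsilon> * ((1 + \<eta>) / (1 - \<eta>))\<^sup>2 \<and> \<eta> \<in> {0<..<1 / 8}"
    by (rule eventually_conj)
  then obtain \<eta> where "0 < (1 - \<epsilon>) * (1 - 8 * \<eta>) - \<epsilon> * ((1 + \<eta>) / (1 - \<eta>))\<^sup>2 \<and> \<eta> \<in> {0<..<1 / 8}"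
    using eventually_happens[of _ "at_right (0 :: real)"] by (auto simp: trivial_limit_at_right_real)
  then show ?thesis
    by (intro that[of \<eta>]) auto
qed

section \<open>Graphs\<close>

lemma sym_adj: "sym (adj G)"
  by (auto simp: adj_def sym_def insert_commute)

lemma adj_iff [simp]: "(u, v) \<in> adj G \<longleftrightarrow> {u, v} \<in> edges G"
  by (simp add: adj_def)

lemma adj_rtrancl_sym: "(u, v) \<in> (adj G)\<^sup>* \<Longrightarrow> (v, u) \<in> (adj G)\<^sup>*"
  using sym_rtrancl[OF sym_adj] by (auto dest: symD)

lemma connected_graphI:
  assumes "r \<in> verts G" "\<And>v. v \<in> verts G \<Longrightarrow> (r, v) \<in> (adj G)\<^sup>*"
  shows "connected_graph G"
  using assms unfolding connected_graph_def by (blast intro: rtrancl_trans adj_rtrancl_sym)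

text \<open>Replacing each edge by a walk preserves reachability; this reduces the deletion of an
  edge to finding a detour for it.\<close>

lemma connected_graph_detour:
  assumes "connected_graph G" "verts H = verts G"
    and "\<And>u v. {u, v} \<in> edges G \<Longrightarrow> (u, v) \<in> (adj H)\<^sup>*"
  shows "connected_graph H"
proof -
  have "adj G \<subseteq> (adj H)\<^sup>*" using assms(3) by auto
  then have "(adj G)\<^sup>* \<subseteq> (adj H)\<^sup>*" by (metis rtrancl_mono rtrancl_idemp)
  then show ?thesis using assms(1,2) unfolding connected_graph_def by auto
qed

lemma connected_graph_mono:
  assumes "connected_graph G" "verts H = verts G" "edges G \<subseteq> edges H"
  shows "connected_graph H"
  using assms by (intro connected_graph_detour[OF assms(1,2)]) (auto intro!: r_into_rtrancl)

text \<open>Otherwise no edge would leave \<open>X\<close> once \<open>{u, v}\<close> is deleted,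
  and \<open>v\<close> would be unreachable from \<open>u\<close>.\<close>

lemma two_edge_connected_cut:
  assumes "two_edge_connected G" "{u, v} \<in> edges G" "u \<in> X" "v \<notin> X"
    "u \<in> verts G" "v \<in> verts G"
  shows "\<exists>a b. {a, b} \<in> edges G \<and> {a, b} \<noteq> {u, v} \<and> a \<in> X \<and> b \<notin> X"
proof (rule ccontr)
  let ?H = "G\<lparr>edges := edges G - {{u, v}}\<rparr>"
  assume *: "\<not> ?thesis"
  have "(u, v) \<in> (adj ?H)\<^sup>*"
    using assms unfolding two_edge_connected_def connected_graph_def by auto
  then have "v \<in> X"
  proof (induction rule: rtrancl_induct)
    case base
    show ?case by fact
  next
    case (step y z)
    then show ?case using * by auto
  qed
  then show False using assms by simp
qed

text \<open>A vertex of greatest rank on a cycle has two distinct neighbours on it, both of smaller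
  rank, against \<open>unique\<close>.\<close>

lemma no_cycle_if_ranked:
  fixes rank :: "nat \<Rightarrow> nat"
  assumes neq: "\<And>u v. {u, v} \<in> edges G \<Longrightarrow> rank u \<noteq> rank v"
    and unique: "\<And>u u' v. \<lbrakk>{u, v} \<in> edges G; {u', v} \<in> edges G; rank u < rank v; rank u' < rank v\<rbrakk> \<Longrightarrow> u = u'"
  shows "\<not> is_cycle G xs"
proof
  assume cyc: "is_cycle G xs"
  define n where "n = length xs"
  have n: "3 \<le> n" and dist: "distinct xs" using cyc by (auto simp: is_cycle_def n_def)
  have "hd xs = xs ! 0" using n by (intro hd_conv_nth) (auto simp: n_def)
  then have nth: "(xs @ [hd xs]) ! i = xs ! (i mod n)" if "i \<le> n" for i
    using that n by (cases "i = n") (auto simp: nth_append n_def)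
  have succ: "{xs ! i, xs ! (Suc i mod n)} \<in> edges G" if "i < n" for i
    using cyc that nth[of i] nth[of "Suc i"] unfolding is_cycle_def successively_conv_nth
    by (auto simp: n_def[symmetric])
  have "Max (rank ` set xs) \<in> rank ` set xs"
    using n by (intro Max_in) (auto simp: n_def)
  then obtain k where k: "k < n" "rank (xs ! k) = Max (rank ` set xs)"
    by (auto simp: in_set_conv_nth n_def)
  have le: "rank (xs ! i) \<le> rank (xs ! k)" if "i < n" for i
    using that k by (auto simp: n_def)
  \<comment> \<open>\<open>a\<close> and \<open>b\<close> are the cyclic successor and predecessor
    of \<open>k\<close>; they differ since \<open>3 \<le> n\<close>.\<close>
  define a where "a = Suc k mod n"
  define b where "b = (if k = 0 then n - 1 else k - 1)"
  have ab: "a < n" "b < n" "a \<noteq> b"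
    using n k by (auto simp: a_def b_def mod_Suc)
  have "Suc b mod n = k" using n k by (auto simp: b_def mod_Suc)
  then have edges: "{xs ! a, xs ! k} \<in> edges G" "{xs ! b, xs ! k} \<in> edges G"
    using succ[OF k(1)] succ[OF ab(2)] by (auto simp: a_def insert_commute)
  then have "rank (xs ! a) < rank (xs ! k)" "rank (xs ! b) < rank (xs ! k)"
    using neq le ab by (metis le_neq_implies_less)+
  then have "xs ! a = xs ! b" using edges unique by blast
  then show False using ab dist by (simp add: nth_eq_iff_index_eq n_def)
qed

section \<open>Distances, diameter and height\<close>

definition reach_within :: "ugraph \<Rightarrow> nat \<Rightarrow> nat \<Rightarrow> nat \<Rightarrow> bool" where
  "reach_within G k u v \<longleftrightarrow> (\<exists>n\<le>k. (u, v) \<in> adj G ^^ n)"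

lemma reach_within_refl [simp]: "reach_within G k u u"
  unfolding reach_within_def by (intro exI[of _ 0]) auto

lemma reach_within_edge: "{u, v} \<in> edges G \<Longrightarrow> reach_within G 1 u v"
  unfolding reach_within_def by (intro exI[of _ 1]) auto

lemma reach_within_trans:
  "reach_within G j u v \<Longrightarrow> reach_within G k v w \<Longrightarrow> reach_within G (j + k) u w"
  unfolding reach_within_def by (meson add_mono relpow_trans)

lemma reach_within_mono: "reach_within G j u v \<Longrightarrow> j \<le> k \<Longrightarrow> reach_within G k u v"
  unfolding reach_within_def by (meson order_trans)

lemma reach_within_sym: "reach_within G k u v \<Longrightarrow> reach_within G k v u"
proof -
  have "(v, u) \<in> adj G ^^ n" if "(u, v) \<in> adj G ^^ n" for n
    using that
  proof (induction n arbitrary: v)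
    case (Suc n)
    then obtain w where "(u, w) \<in> adj G ^^ n" "(w, v) \<in> adj G" by auto
    then show ?case using Suc.IH by (intro relpow_Suc_I2[of v w]) (auto simp: insert_commute)
  qed simp
  then show "reach_within G k u v \<Longrightarrow> reach_within G k v u"
    unfolding reach_within_def by blast
qed

lemma reach_within_rtrancl: "reach_within H k u v \<Longrightarrow> (u, v) \<in> (adj H)\<^sup>*"
  unfolding reach_within_def by (auto intro: relpow_imp_rtrancl)

lemma graph_dist_le: "reach_within G k u v \<Longrightarrow> graph_dist G u v \<le> k"
  unfolding reach_within_def graph_dist_def by (meson Least_le order_trans)

text \<open>\<open>f\<close> is a potential that grows by at most \<open>c\<close> along an edge of
  a shortest walk. Reachability matters, as the \<open>LEAST\<close> in \<open>graph_dist\<close> is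
  unspecified otherwise.\<close>

lemma graph_dist_ge:
  fixes f :: "nat \<Rightarrow> nat"
  assumes lip: "\<And>u v. {u, v} \<in> edges G \<Longrightarrow> f v \<le> f u + c" and "(u, v) \<in> (adj G)\<^sup>*"
  shows "f v \<le> f u + c * graph_dist G u v"
proof -
  have "(u, v) \<in> adj G ^^ n \<Longrightarrow> f v \<le> f u + c * n" for n
  proof (induction n arbitrary: v)
    case (Suc n)
    then obtain w where "(u, w) \<in> adj G ^^ n" "{w, v} \<in> edges G" by auto
    then show ?case using Suc.IH[of w] lip[of w v] by simp
  qed simp
  moreover have "(u, v) \<in> adj G ^^ graph_dist G u v"
    using assms(2) unfolding graph_dist_def rtrancl_power by (rule LeastI_ex)
  ultimately show ?thesis by blast
qed

lemma graph_diameter_le: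
  assumes "finite (verts G)" "r \<in> verts G" "\<And>v. v \<in> verts G \<Longrightarrow> reach_within G k r v"
  shows "graph_diameter G \<le> 2 * k"
proof -
  have "graph_dist G u v \<le> 2 * k" if "u \<in> verts G" "v \<in> verts G" for u v
    using reach_within_trans[OF reach_within_sym[OF assms(3)] assms(3), OF that]
    by (intro graph_dist_le) (simp add: mult_2)
  moreover have "finite {graph_dist G u v | u v. u \<in> verts G \<and> v \<in> verts G}"
    using assms(1) by (auto intro: finite_image_set2)
  ultimately show ?thesis
    unfolding graph_diameter_def using assms(2) by (subst Max_le_iff) auto
qed

lemma graph_dist_le_diameter:
  assumes "finite (verts G)" "u \<in> verts G" "v \<in> verts G"
  shows "graph_dist G u v \<le> graph_diameter G"
proof -
  have "{graph_dist G u v | u v. u \<in> verts G \<and> v \<in> verts G} = (\<lambda>(u, v). graph_dist G u v) ` (verts G \<times> verts G)"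
    by auto
  then show ?thesis
    unfolding graph_diameter_def using assms by (auto intro!: Max_ge)
qed

lemma tree_height_le:
  assumes "finite (verts G)" "verts G \<noteq> {}" "\<And>v. v \<in> verts G \<Longrightarrow> reach_within (spanning G T) k r v"
  shows "tree_height G T r \<le> k"
  unfolding tree_height_def using assms by (subst Max_le_iff) (auto intro: graph_dist_le simp: Setcompr_eq_image)

lemma graph_dist_le_tree_height:
  assumes "finite (verts G)" "v \<in> verts G"
  shows "graph_dist (spanning G T) r v \<le> tree_height G T r"
  unfolding tree_height_def using assms by (intro Max_ge) (auto simp: Setcompr_eq_image)

section \<open>The hard instance\<close>

abbreviation vx :: "nat \<Rightarrow> nat \<Rightarrow> nat" where
  "vx i j \<equiv> prod_encode (i, j)"

definition pos :: "nat \<Rightarrow> nat" where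
  "pos v = snd (prod_decode v)"

lemma pos_vx [simp]: "pos (vx i j) = j"
  by (simp add: pos_def)

text \<open>Vertex \<open>vx i j\<close> is the one at position \<open>j\<close> of leg \<open>i\<close>.  Leg \<open>0\<close> is the spine; its last \<open>m\<close>
  vertices carry no rungs and no long skip edges, and only serve to make the diameter large.\<close>

locale comb =
  fixes N l m q :: nat
  assumes N: "1 \<le> N" and l: "4 \<le> l" and m: "1 \<le> m" and q: "l \<le> 2 ^ q"
begin

definition len :: "nat \<Rightarrow> nat" where
  "len i = (if i = 0 then l + m else l)"

definition V :: "nat set" where
  "V = {vx i j | i j. i \<le> N \<and> j < len i}"

definition rung :: "nat \<Rightarrow> nat \<Rightarrow> nat set" where
  "rung i j = {vx 0 j, vx i j}"

definition T :: "nat set set" where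
  "T = {{vx i j, vx i (Suc j)} | i j. i \<le> N \<and> Suc j < len i} \<union> {rung i 0 | i. 1 \<le> i \<and> i \<le> N}"

text \<open>The edges between positions \<open>j\<close> and \<open>j + 2\<close> put every leg edge
  on a triangle. In the second set, \<open>2 ^ k dvd j\<close> leaves at most one skip edge of each
  level \<open>k\<close> over a given position, and still every spine position below
  \<open>l\<close> is reached by clearing binary digits.\<close>

definition inner :: "nat set set" where
  "inner = {{vx i j, vx i (j + 2)} | i j. i \<le> N \<and> j + 2 < len i}
    \<union> {{vx 0 j, vx 0 (j + 2 ^ k)} | j k. 2 ^ k dvd j \<and> j + 2 ^ k < l}"

definition rungs :: "nat set set" where
  "rungs = {rung i j | i j. 1 \<le> i \<and> i \<le> N \<and> 1 \<le> j \<and> j < l}"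

definition net :: "nat set set \<Rightarrow> ugraph" where
  "net F = \<lparr>verts = V, edges = F\<rparr>"

definition G :: ugraph where
  "G = net (T \<union> inner \<union> rungs)"

lemma verts_net [simp]: "verts (net F) = V" and edges_net [simp]: "edges (net F) = F"
  by (simp_all add: net_def)

lemma verts_G [simp]: "verts G = V" and edges_G [simp]: "edges G = T \<union> inner \<union> rungs"
  by (simp_all add: G_def)

lemma spanning_G [simp]: "spanning G F = net F"
  by (simp add: spanning_def net_def G_def)

lemma net_delete [simp]: "net F\<lparr>edges := F'\<rparr> = net F'"
  by (simp add: net_def)

lemma vx_in_V [simp]: "vx i j \<in> V \<longleftrightarrow> i \<le> N \<and> j < len i"
  by (auto simp: V_def)

lemma V_cases:
  assumes "v \<in> V"
  obtains i j where "v = vx i j" "i \<le> N" "j < len i"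
  using assms by (auto simp: V_def)

lemma len_ge: "l \<le> len i"
  by (simp add: len_def)

lemma V_eq: "V = prod_encode ` (SIGMA i:{..N}. {..<len i})"
  by (auto simp: V_def)

lemma finite_V [simp]: "finite V"
  by (simp add: V_eq)

lemma card_V: "card V = (N + 1) * l + m"
proof -
  have "{..N} = insert 0 {1..N}" by auto
  then have "(\<Sum>i\<le>N. len i) = len 0 + (\<Sum>i\<in>{1..N}. len i)" by simp
  also have "(\<Sum>i\<in>{1..N}. len i) = N * l" by (simp add: len_def)
  finally show ?thesis
    unfolding V_eq by (subst card_image) (auto simp: len_def inj_prod_encode)
qed

text \<open>\<open>pos u \<le> pos v\<close> orients edges to the right. A rung stays on one
  position, so its ends cannot be told apart and only the edge itself is described; position
  \<open>0\<close> is the tree rung.\<close>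

lemma edge_cases:
  assumes "{u, v} \<in> T \<union> inner \<union> rungs" "pos u \<le> pos v"
  obtains (leg) i j where "u = vx i j" "v = vx i (Suc j)" "i \<le> N" "Suc j < len i" "{u, v} \<in> T"
  | (brace) i j where "u = vx i j" "v = vx i (j + 2)" "i \<le> N" "j + 2 < len i" "{u, v} \<in> inner"
  | (skip) j k where "u = vx 0 j" "v = vx 0 (j + 2 ^ k)" "2 ^ k dvd j" "j + 2 ^ k < l" "{u, v} \<in> inner"
  | (rung) i j where "{u, v} = rung i j" "1 \<le> i" "i \<le> N" "j < l" "{u, v} \<in> (if j = 0 then T else rungs)"
proof -
  consider "{u, v} \<in> T" | "{u, v} \<in> inner" | "{u, v} \<in> rungs" using assms by auto
  then show ?thesis
  proof cases
    case 1
    then consider i j where "{u, v} = {vx i j, vx i (Suc j)}" "i \<le> N" "Suc j < len i"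
      | i where "{u, v} = rung i 0" "1 \<le> i" "i \<le> N" unfolding T_def by blast
    then show ?thesis
    proof cases
      case 1
      with assms(2) have "u = vx i j \<and> v = vx i (Suc j)"
        by (auto simp: doubleton_eq_iff)
      then show ?thesis using 1 \<open>{u, v} \<in> T\<close> by (intro leg) auto
    next
      case 2
      then show ?thesis using \<open>{u, v} \<in> T\<close> l by (intro rung[of i 0]) auto
    qed
  next
    case 2
    then consider i j where "{u, v} = {vx i j, vx i (j + 2)}" "i \<le> N" "j + 2 < len i"
      | j k where "{u, v} = {vx 0 j, vx 0 (j + 2 ^ k)}" "2 ^ k dvd j" "j + 2 ^ k < l" unfolding inner_def by blast
    then show ?thesis
    proof cases
      case 1
      with assms(2) have "u = vx i j \<and> v = vx i (j + 2)"
        by (auto simp: doubleton_eq_iff)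
      then show ?thesis using 1 \<open>{u, v} \<in> inner\<close> by (intro brace) auto
    next
      case (2 j k)
      with assms(2) have "u = vx 0 j \<and> v = vx 0 (j + 2 ^ k)"
        by (auto simp: doubleton_eq_iff)
      then show ?thesis using 2 \<open>{u, v} \<in> inner\<close> by (intro skip) auto
    qed
  next
    case 3
    then obtain i j where "{u, v} = rung i j" "1 \<le> i" "i \<le> N" "1 \<le> j" "j < l" unfolding rungs_def by blast
    then show ?thesis using 3 by (intro rung[of i j]) auto
  qed
qed

lemma edges_in_V: "e \<in> T \<union> inner \<union> rungs \<Longrightarrow> \<exists>u v. e = {u, v} \<and> u \<in> V \<and> v \<in> V \<and> u \<noteq> v"
  unfolding T_def inner_def rungs_def rung_def using l len_ge
  by (fastforce simp: len_def)

lemma simple_G: "simple_graph G"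
  unfolding simple_graph_def using edges_in_V by auto

lemma finite_edges [simp]: "finite (T \<union> inner \<union> rungs)"
proof (rule finite_subset)
  show "T \<union> inner \<union> rungs \<subseteq> Pow V" using edges_in_V by fastforce
qed simp

lemma leg_in_T: "i \<le> N \<Longrightarrow> Suc j < len i \<Longrightarrow> {vx i j, vx i (Suc j)} \<in> T"
  unfolding T_def by blast

lemma brace_inner: "i \<le> N \<Longrightarrow> j + 2 < len i \<Longrightarrow> {vx i j, vx i (j + 2)} \<in> inner"
  unfolding inner_def by blast

lemma skip_inner: "2 ^ k dvd j \<Longrightarrow> j + 2 ^ k < l \<Longrightarrow> {vx 0 j, vx 0 (j + 2 ^ k)} \<in> inner"
  unfolding inner_def by blast

lemma rung_0_in_T: "1 \<le> i \<Longrightarrow> i \<le> N \<Longrightarrow> rung i 0 \<in> T"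
  unfolding T_def by blast

section \<open>The spanning tree, its height, and the diameter of the network\<close>

definition rank :: "nat \<Rightarrow> nat" where
  "rank v = pos v + (if fst (prod_decode v) = 0 then 0 else 1)"

lemma rank_vx [simp]: "rank (vx i j) = j + (if i = 0 then 0 else 1)"
  by (simp add: rank_def)

lemma T_cases:
  assumes "{u, v} \<in> T" "rank u \<le> rank v"
  shows "(\<exists>i j. u = vx i j \<and> v = vx i (Suc j)) \<or> (\<exists>i. 1 \<le> i \<and> u = vx 0 0 \<and> v = vx i 0)"
proof -
  from assms consider i j where "{u, v} = {vx i j, vx i (Suc j)}"
      | i where "{u, v} = {vx 0 0, vx i 0}" "1 \<le> i" unfolding T_def rung_def by blast
  then show ?thesis
    using assms(2) by cases (auto simp: doubleton_eq_iff)
qed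

lemma T_rank:
  assumes "{u, v} \<in> T"
  shows "rank u = Suc (rank v) \<or> rank v = Suc (rank u)"
  using T_cases[of u v] T_cases[of v u] assms by (fastforce simp: insert_commute)

text \<open>\<open>rank\<close> is the depth below the root \<open>vx 0 0\<close>, with one extra
  step for the rung that attaches a leg; no vertex has two tree neighbours of smaller rank.\<close>

lemma T_no_cycle: "\<not> is_cycle (net T) xs"
proof (rule no_cycle_if_ranked[where rank = rank])
  fix u v assume "{u, v} \<in> edges (net T)"
  then show "rank u \<noteq> rank v" using T_rank[of u v] by auto
next
  fix u u' v assume "{u, v} \<in> edges (net T)" "{u', v} \<in> edges (net T)" "rank u < rank v" "rank u' < rank v"
  then show "u = u'" using T_cases[of u v] T_cases[of u' v] by auto
qed

lemma reach_leg:
  assumes "i \<le> N" "j + d < len i"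
  shows "reach_within (net T) d (vx i j) (vx i (j + d))"
  using assms(2)
proof (induction d)
  case (Suc d)
  then have "reach_within (net T) (d + 1) (vx i j) (vx i (Suc (j + d)))"
    using leg_in_T[OF assms(1), of "j + d"] by (intro reach_within_trans reach_within_edge) auto
  then show ?case by simp
qed simp

lemma reach_tree:
  assumes "v \<in> V"
  shows "reach_within (net T) (l + m) (vx 0 0) v"
proof -
  from assms obtain i j where v: "v = vx i j" "i \<le> N" "j < len i" by (rule V_cases)
  show ?thesis
  proof (cases "i = 0")
    case True
    then show ?thesis
      using reach_leg[of 0 0 j] v by (auto simp: len_def intro: reach_within_mono)
  next
    case False
    have "reach_within (net T) (1 + j) (vx 0 0) (vx i (0 + j))"
      using rung_0_in_T[of i] False v
      by (intro reach_within_trans[OF reach_within_edge reach_leg]) (auto simp: rung_def)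
    then show ?thesis
      using v False m by (auto simp: len_def intro: reach_within_mono)
  qed
qed

lemma root_in_V: "vx 0 0 \<in> V"
  using l by (simp add: len_def)

lemma connected_T: "connected_graph (net T)"
  using root_in_V reach_tree by (intro connected_graphI[of "vx 0 0"]) (auto intro: reach_within_rtrancl)

lemma spanning_tree_T: "spanning_tree G T"
  unfolding spanning_tree_def using connected_T T_no_cycle by auto

lemma height_le: "tree_height G T (vx 0 0) \<le> l + m"
proof (rule tree_height_le)
  show "verts G \<noteq> {}" using root_in_V by (metis empty_iff verts_G)
qed (use reach_tree in auto)

lemma height_ge: "l \<le> tree_height G T (vx 0 0)"
proof -
  \<comment> \<open>The end of the tail has depth \<open>l + m - 1\<close>, which is at least
    \<open>l\<close> as \<open>1 \<le> m\<close>.\<close>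
  define v where "v = vx 0 (l + m - 1)"
  have v: "v \<in> V" using m by (auto simp: v_def len_def)
  have "rank v \<le> rank (vx 0 0) + 1 * graph_dist (net T) (vx 0 0) v"
  proof (rule graph_dist_ge)
    show "(vx 0 0, v) \<in> (adj (net T))\<^sup>*"
      using reach_tree[OF v] by (rule reach_within_rtrancl)
  qed (use T_rank in fastforce)
  moreover have "graph_dist (spanning G T) (vx 0 0) v \<le> tree_height G T (vx 0 0)"
    using v by (intro graph_dist_le_tree_height) auto
  ultimately show ?thesis using m by (simp add: v_def)
qed

text \<open>Only the binary digits \<open>k\<close> to \<open>k + s - 1\<close> of \<open>j\<close>
  can be set. Each set digit costs one skip edge: clearing the lowest one, \<open>k\<close>, leaves
  a multiple of \<open>2 ^ Suc k\<close>.\<close>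

lemma reach_spine:
  assumes "2 ^ k dvd j" "j < 2 ^ (k + s)" "j < l"
  shows "reach_within G s (vx 0 0) (vx 0 j)"
  using assms
proof (induction s arbitrary: k j)
  case 0
  then have "j = 0" by (metis add_0_right dvd_imp_le gr0I not_le)
  then show ?case by simp
next
  case (Suc s)
  show ?case
  proof (cases "2 ^ Suc k dvd j")
    case True
    then have "reach_within G s (vx 0 0) (vx 0 j)"
      using Suc.prems by (intro Suc.IH[of "Suc k"]) auto
    then show ?thesis by (rule reach_within_mono) simp
  next
    case False
    obtain a where a: "j = 2 ^ k * a" using Suc.prems(1) by (auto elim: dvdE)
    then have "odd a" using False by auto
    then obtain b where b: "a = 2 * b + 1" by (auto elim: oddE)
    define i where "i = 2 ^ Suc k * b"
    have j: "j = i + 2 ^ k" by (simp add: a b i_def algebra_simps)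
    have dv: "2 ^ Suc k dvd i" by (simp add: i_def)
    then have "2 ^ k dvd i" by (meson dvd_trans le_imp_power_dvd le_SucI order_refl)
    then have "{vx 0 i, vx 0 j} \<in> edges G"
      using Suc.prems(3) skip_inner[of k i] by (simp add: j)
    moreover have "reach_within G s (vx 0 0) (vx 0 i)"
      using Suc.prems dv j by (intro Suc.IH[of "Suc k"]) auto
    ultimately show ?thesis
      using reach_within_trans[OF _ reach_within_edge] by fastforce
  qed
qed

lemma reach_G:
  assumes "v \<in> V"
  shows "reach_within G (q + m + 1) (vx 0 0) v"
proof -
  from assms obtain i j where v: "v = vx i j" "i \<le> N" "j < len i" by (rule V_cases)
  have spine: "reach_within G q (vx 0 0) (vx 0 j)" if "j < l" for j
    using that q by (intro reach_spine[of 0]) auto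
  consider "j < l" "i = 0" | "j < l" "1 \<le> i" | "l \<le> j" "i = 0"
    using v by (auto simp: len_def split: if_splits) linarith
  then show ?thesis
  proof cases
    case 1
    then show ?thesis using spine[of j] v by (auto intro: reach_within_mono)
  next
    case 2
    have "{vx 0 j, vx i j} \<in> edges G"
      using 2 v rung_0_in_T[of i] by (cases "j = 0") (auto simp: rungs_def rung_def)
    then have "reach_within G (q + 1) (vx 0 0) v"
      unfolding v using spine[OF 2(1)] by (intro reach_within_trans[OF _ reach_within_edge])
    then show ?thesis by (rule reach_within_mono) simp
  next
    case 3
    have adj: "{vx 0 j, vx 0 (Suc j)} \<in> edges G" if "Suc j < l + m" for j
      using leg_in_T[of 0 j] that by (auto simp: len_def)
    have "l - 1 + d < l + m \<Longrightarrow> reach_within G d (vx 0 (l - 1)) (vx 0 (l - 1 + d))" for d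
    proof (induction d)
      case (Suc d)
      then have "reach_within G (d + 1) (vx 0 (l - 1)) (vx 0 (Suc (l - 1 + d)))"
        using adj[of "l - 1 + d"] by (intro reach_within_trans[OF _ reach_within_edge]) auto
      then show ?case by simp
    qed simp
    from this[of "j - (l - 1)"] have "reach_within G (j - (l - 1)) (vx 0 (l - 1)) v"
      using 3 v l by (simp add: len_def)
    with spine[of "l - 1"] have "reach_within G (q + (j - (l - 1))) (vx 0 0) v"
      using l by (intro reach_within_trans[of _ _ _ "vx 0 (l - 1)"]) auto
    then show ?thesis
      using 3 v by (elim reach_within_mono) (simp add: len_def)
  qed
qed

lemma diameter_le: "graph_diameter G \<le> 2 * (q + m + 1)"
  using reach_G root_in_V by (intro graph_diameter_le) auto

lemma diameter_ge: "m \<le> 2 * graph_diameter G"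
proof -
  \<comment> \<open>\<open>f\<close> counts the steps into the tail; skip edges and rungs lie where
    it is \<open>0\<close>, and the other edges change it by at most \<open>2\<close>.\<close>
  define f where "f v = (if fst (prod_decode v) = 0 then pos v - (l - 1) else 0)" for v
  define v where "v = vx 0 (l + m - 1)"
  have v: "v \<in> V" using m by (auto simp: v_def len_def)
  have f_le: "f b \<le> f a + 2 \<and> f a \<le> f b + 2" if "{a, b} \<in> edges G" "pos a \<le> pos b" for a b
    using that unfolding edges_G by (cases rule: edge_cases) (auto simp: f_def rung_def doubleton_eq_iff)
  have "f v \<le> f (vx 0 0) + 2 * graph_dist G (vx 0 0) v"
  proof (rule graph_dist_ge)
    show "(vx 0 0, v) \<in> (adj G)\<^sup>*"
      using reach_G[OF v] by (rule reach_within_rtrancl)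
    show "f b \<le> f a + 2" if "{a, b} \<in> edges G" for a b
      using f_le[of a b] f_le[of b a] that by (cases "pos a \<le> pos b") (auto simp: insert_commute)
  qed
  moreover have "graph_dist G (vx 0 0) v \<le> graph_diameter G"
    using v root_in_V by (intro graph_dist_le_diameter) auto
  ultimately show ?thesis using l by (simp add: v_def f_def)
qed

section \<open>Two-edge-connectivity\<close>

lemma two_edge_connected_net:
  assumes sub: "T \<union> inner \<subseteq> F" and rung: "\<And>i. 1 \<le> i \<Longrightarrow> i \<le> N \<Longrightarrow> \<exists>j. 1 \<le> j \<and> j < l \<and> rung i j \<in> F"
  shows "two_edge_connected (net F)"
proof -
  have conn: "connected_graph (net F)"
    by (rule connected_graph_mono[OF connected_T]) (use sub in auto)
  moreover have "connected_graph (net (F - {e}))" if "e \<in> F" for e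
  proof (cases "e \<in> T")
    case False
    then show ?thesis
      using sub by (intro connected_graph_mono[OF connected_T]) auto
  next
    case True
    let ?H = "net (F - {e})"
    have step: "(u, v) \<in> (adj ?H)\<^sup>*" if "{u, v} \<in> T \<union> inner" "{u, v} \<noteq> e" for u v
      by (rule r_into_rtrancl) (use that sub in auto)
    have "\<exists>u v. e = {u, v} \<and> (u, v) \<in> (adj ?H)\<^sup>*"
    proof -
      from True consider (leg) i j where "e = {vx i j, vx i (Suc j)}" "i \<le> N" "Suc j < len i"
        | (rung) i where "e = rung i 0" "1 \<le> i" "i \<le> N" unfolding T_def by blast
      then show ?thesis
      proof cases
        case leg
        have "(vx i j, vx i (Suc j)) \<in> (adj ?H)\<^sup>*"
        \<comment> \<open>The deleted leg edge lies on a triangle with a brace, to its right if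
          there is room and otherwise to its left.\<close>
        proof (cases "j + 2 < len i")
          case True
          have "(vx i j, vx i (j + 2)) \<in> (adj ?H)\<^sup>*"
            using brace_inner[of i j] leg True by (intro step) (auto simp: doubleton_eq_iff)
          moreover have "(vx i (Suc j), vx i (j + 2)) \<in> (adj ?H)\<^sup>*"
            using leg_in_T[of i "Suc j"] leg True by (intro step) (auto simp: doubleton_eq_iff)
          ultimately show ?thesis by (rule rtrancl_trans[OF _ adj_rtrancl_sym])
        next
          case False
          with len_ge[of i] l obtain j' where j': "j = Suc j'" by (cases j) auto
          have 1: "(vx i j', vx i (Suc j)) \<in> (adj ?H)\<^sup>*"
            using brace_inner[of i j'] leg j' by (intro step) (auto simp: doubleton_eq_iff)
          have 2: "(vx i j', vx i j) \<in> (adj ?H)\<^sup>*"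
            using leg_in_T[of i j'] leg j' by (intro step) (auto simp: doubleton_eq_iff)
          show ?thesis by (rule rtrancl_trans[OF adj_rtrancl_sym[OF 2] 1])
        qed
        then show ?thesis using leg by blast
      next
        \<comment> \<open>A deleted tree rung is bypassed along the spine, over the other rung in
          \<open>F\<close>, and back along the leg.\<close>
        case (rung i)
        have leg: "j < len h \<Longrightarrow> (vx h 0, vx h j) \<in> (adj ?H)\<^sup>*" if "h \<le> N" for h j
        proof (induction j)
          case (Suc j)
          have "(vx h j, vx h (Suc j)) \<in> (adj ?H)\<^sup>*"
            using leg_in_T[of h j] that Suc.prems rung
            by (intro step) (auto simp: rung_def doubleton_eq_iff)
          moreover have "(vx h 0, vx h j) \<in> (adj ?H)\<^sup>*"
            using Suc by simp
          ultimately show ?case by (rule rtrancl_trans[rotated])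
        qed simp
        obtain j where j: "1 \<le> j" "j < l" "rung i j \<in> F" using assms(2) rung by blast
        then have 1: "(vx 0 j, vx i j) \<in> (adj ?H)\<^sup>*"
          by (intro r_into_rtrancl) (use rung in \<open>auto simp: rung_def doubleton_eq_iff\<close>)
        have 2: "(vx 0 0, vx 0 j) \<in> (adj ?H)\<^sup>*" "(vx i 0, vx i j) \<in> (adj ?H)\<^sup>*"
          using leg[of 0 j] leg[of i j] j rung(2,3) len_ge[of 0] len_ge[of i] by simp_all
        have "(vx 0 0, vx i 0) \<in> (adj ?H)\<^sup>*"
          by (rule rtrancl_trans[OF rtrancl_trans[OF 2(1) 1] adj_rtrancl_sym[OF 2(2)]])
        then show ?thesis using rung by (auto simp: rung_def)
      qed
    qed
    then obtain u v where e: "e = {u, v}" "(u, v) \<in> (adj ?H)\<^sup>*" by blast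
    show ?thesis
    proof (rule connected_graph_detour[OF conn])
      fix a b assume ab: "{a, b} \<in> edges (net F)"
      show "(a, b) \<in> (adj ?H)\<^sup>*"
      proof (cases "{a, b} = e")
        case True
        then show ?thesis using e adj_rtrancl_sym by (metis doubleton_eq_iff)
      next
        case False
        then show ?thesis using ab by (intro r_into_rtrancl) auto
      qed
    qed simp
  qed
  ultimately show ?thesis
    unfolding two_edge_connected_def by simp
qed

lemma two_edge_connected_G: "two_edge_connected G"
  unfolding G_def
proof (rule two_edge_connected_net)
  fix i assume "1 \<le> i" "i \<le> N"
  then have "rung i 1 \<in> rungs" unfolding rungs_def using l by fastforce
  then show "\<exists>j\<ge>1. j < l \<and> rung i j \<in> T \<union> inner \<union> rungs" using l by (intro exI[of _ 1]) auto
qed auto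

section \<open>Weights encoding two sets, and the resulting optima\<close>

definition wt :: "nat set \<Rightarrow> nat set \<Rightarrow> nat set \<Rightarrow> nat" where
  "wt x y e = (if \<exists>i j. e = rung i j \<and> 1 \<le> i \<and> i \<le> N \<and> 1 \<le> j \<and> j < l \<and> (j = 1 \<longrightarrow> i \<in> x) \<and> (j = l - 1 \<longrightarrow> i \<in> y)
    then 1 else 0)"

lemma rung_eq_iff: "1 \<le> i \<Longrightarrow> rung i j = rung i' j' \<longleftrightarrow> i = i' \<and> j = j'"
  by (auto simp: rung_def doubleton_eq_iff)

lemma wt_rung:
  assumes "1 \<le> i" "i \<le> N" "1 \<le> j" "j < l"
  shows "wt x y (rung i j) = of_bool ((j = 1 \<longrightarrow> i \<in> x) \<and> (j = l - 1 \<longrightarrow> i \<in> y))"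
  using assms by (auto simp: wt_def rung_eq_iff)

lemma rung_notin:
  assumes "1 \<le> i" "1 \<le> j"
  shows "rung i j \<notin> T \<union> inner"
  using assms by (auto simp: T_def inner_def rung_def doubleton_eq_iff)

lemma wt_inner: "e \<in> T \<union> inner \<Longrightarrow> wt x y e = 0"
  using rung_notin by (auto simp: wt_def)

lemma weight_fun_wt: "weight_fun G k (wt x y)"
  using l by (auto simp: weight_fun_def wt_def card_V)

lemma finite_augmentations: "finite {\<Sum>e\<in>Aug. w e | Aug. augmentation G T Aug}"
proof (rule finite_subset)
  show "{\<Sum>e\<in>Aug. w e | Aug. augmentation G T Aug} \<subseteq> sum w ` Pow (edges G)"
    by (auto simp: augmentation_def)
  show "finite (sum w ` Pow (edges G))"
    by (simp only: edges_G finite_imageI finite_Pow_iff finite_edges)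
qed

text \<open>Every leg keeps a free rung: the one at position \<open>1\<close> if
  \<open>i \<notin> x\<close>, otherwise the one at \<open>l - 1\<close>, as then
  \<open>i \<notin> y\<close>.\<close>

lemma tap_opt_eq_0:
  assumes "x \<inter> y = {}"
  shows "tap_opt G T (wt x y) = 0"
proof -
  define Aug where "Aug = {e \<in> edges G. wt x y e = 0}"
  have "two_edge_connected (net (T \<union> Aug))"
  proof (rule two_edge_connected_net)
    show "T \<union> inner \<subseteq> T \<union> Aug" using wt_inner by (auto simp: Aug_def)
  next
    fix i assume i: "1 \<le> i" "i \<le> N"
    define j where "j = (if i \<in> x then l - 1 else 1)"
    have j: "1 \<le> j" "j < l" using l by (auto simp: j_def)
    have "wt x y (rung i j) = 0"
      using assms l wt_rung[OF i j] by (auto simp: j_def)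
    moreover have "rung i j \<in> rungs" using i j by (auto simp: rungs_def)
    ultimately show "\<exists>j\<ge>1. j < l \<and> rung i j \<in> T \<union> Aug" using j by (auto simp: Aug_def)
  qed
  then have "augmentation G T Aug" by (auto simp: augmentation_def Aug_def)
  then have "tap_opt G T (wt x y) \<le> (\<Sum>e\<in>Aug. wt x y e)"
    unfolding tap_opt_def using finite_augmentations by (intro Min_le) auto
  then show ?thesis by (simp add: Aug_def)
qed

text \<open>Only rungs leave leg \<open>i\<close>. The tree has the one at position
  \<open>0\<close>, so a second one must be in \<open>Aug\<close>, and all of these cost
  \<open>1\<close> when \<open>i\<close> is in both sets. The vertex \<open>v\<close> is one that
  sees this edge locally.\<close>

lemma augmentation_heavy_edge:
  assumes aug: "augmentation G T Aug" and i: "i \<in> x" "i \<in> y" "1 \<le> i" "i \<le> N"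
  obtains v e where "v \<in> V" "v \<in> e" "e \<in> Aug" "wt x y e \<noteq> 0"
proof -
  define X where "X = {vx i j | j. True}"
  have sub: "Aug \<subseteq> edges G" using aug by (simp add: augmentation_def)
  have "\<exists>a b. {a, b} \<in> edges (net (T \<union> Aug)) \<and> {a, b} \<noteq> {vx i 0, vx 0 0} \<and> a \<in> X \<and> b \<notin> X"
    using aug rung_0_in_T[of i] i l by (intro two_edge_connected_cut)
      (auto simp: augmentation_def X_def rung_def len_def insert_commute)
  then obtain a b where ab: "{a, b} \<in> T \<union> Aug" "{a, b} \<noteq> {vx i 0, vx 0 0}" "a \<in> X" "b \<notin> X" by auto
  have "\<exists>h j. {a, b} = rung h j \<and> 1 \<le> h \<and> h \<le> N \<and> j < l"
  proof (cases "pos a \<le> pos b")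
    case True
    from ab(1) sub have "{a, b} \<in> T \<union> inner \<union> rungs" by auto
    from this True show ?thesis by (cases rule: edge_cases) (use ab i in \<open>auto simp: X_def\<close>)
  next
    case False
    from ab(1) sub have "{b, a} \<in> T \<union> inner \<union> rungs" by (auto simp: insert_commute)
    moreover from False have "pos b \<le> pos a" by simp
    ultimately show ?thesis by (cases rule: edge_cases) (use ab i in \<open>auto simp: X_def insert_commute\<close>)
  qed
  then obtain h j where r: "{a, b} = rung h j" "1 \<le> h" "h \<le> N" "j < l" by blast
  with ab i have "h = i" by (auto simp: X_def rung_def doubleton_eq_iff)
  with ab r have j: "1 \<le> j" by (cases j) (auto simp: rung_def insert_commute)
  have "rung i j \<in> Aug" using ab(1) r rung_notin[of i j] i j \<open>h = i\<close> by auto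
  moreover have "wt x y (rung i j) \<noteq> 0" using wt_rung[of i j x y] i j r \<open>h = i\<close> by simp
  moreover have "vx i j \<in> V" "vx i j \<in> rung i j" using i r len_ge[of i] by (auto simp: rung_def)
  ultimately show ?thesis using that by blast
qed

section \<open>Long edges across a position\<close>

definition crossing :: "nat \<Rightarrow> (nat \<times> nat) set" where
  "crossing p = {(u, v). {u, v} \<in> edges G \<and> pos u < p \<and> p \<le> pos v \<and> pos u + 2 < pos v}"

text \<open>A skip edge of level \<open>k\<close> over the cut before \<open>p\<close> starts at the
  last multiple of \<open>2 ^ k\<close> below \<open>p\<close>, so there is at most one per level,
  and \<open>2 ^ k < l \<le> 2 ^ q\<close>. Edges spanning at most two positions are left out of
  \<open>crossing\<close>, since the simulation gives up two positions per round.\<close>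

lemma crossing_subset:
  "crossing p \<subseteq> (\<lambda>k. (vx 0 (2 ^ k * ((p - 1) div 2 ^ k)), vx 0 (2 ^ k * ((p - 1) div 2 ^ k) + 2 ^ k))) ` {..<q}"
proof clarify
  fix u v assume "(u, v) \<in> crossing p"
  then have uv: "{u, v} \<in> T \<union> inner \<union> rungs" "pos u \<le> pos v" "pos u < p" "p \<le> pos v" "pos u + 2 < pos v"
    by (auto simp: crossing_def)
  from uv(1,2) have "\<exists>j k. u = vx 0 j \<and> v = vx 0 (j + 2 ^ k) \<and> 2 ^ k dvd j \<and> j + 2 ^ k < l"
    by (cases rule: edge_cases) (use uv(3-5) in \<open>auto simp: rung_def doubleton_eq_iff\<close>)
  then obtain j k where jk: "u = vx 0 j" "v = vx 0 (j + 2 ^ k)" "2 ^ k dvd j" "j + 2 ^ k < l" by blast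
  obtain a where a: "j = 2 ^ k * a" using jk(3) by (auto elim: dvdE)
  have "(p - 1) div 2 ^ k = a"
    using uv(3,4) jk by (intro div_nat_eqI) (auto simp: a)
  moreover have "k < q"
  proof -
    have "(2 :: nat) ^ k < 2 ^ q" using jk(4) q by linarith
    then show ?thesis by simp
  qed
  ultimately show "(u, v) \<in> (\<lambda>k. (vx 0 (2 ^ k * ((p - 1) div 2 ^ k)), vx 0 (2 ^ k * ((p - 1) div 2 ^ k) + 2 ^ k))) ` {..<q}"
    using jk(1,2) a by auto
qed

lemma finite_crossing [simp]: "finite (crossing p)"
  using crossing_subset by (rule finite_subset) simp

lemma card_crossing: "card (crossing p) \<le> q"
  using surj_card_le[OF _ crossing_subset] by simp

end

section \<open>Two-player simulation\<close>

lemma card_words_le: "card {w :: bool list. length w \<le> B} \<le> 2 ^ Suc B"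
proof -
  have "{w :: bool list. length w \<le> B} = {w. set w \<subseteq> UNIV \<and> length w \<le> B}" by auto
  then have "card {w :: bool list. length w \<le> B} = (\<Sum>i\<le>B. 2 ^ i)"
    using card_lists_length_le[of "UNIV :: bool set" B] by simp
  also have "\<dots> \<le> 2 ^ Suc B"
    by (induction B) auto
  finally show ?thesis .
qed

lemma finite_words: "finite {w :: bool list. length w \<le> B}"
  using finite_lists_length_le[of "UNIV :: bool set" B] by simp

lemma prob_space_coin_space: "prob_space (coin_space G)"
  unfolding coin_space_def
  by (intro prob_space_PiM prob_space_measure_pmf)

context comb begin

abbreviation info :: "nat set \<Rightarrow> nat set \<Rightarrow> nat \<Rightarrow> local_info" where
  "info x y \<equiv> local_input G T (vx 0 0) (wt x y)"

section \<open>Cutting and pasting runs of an algorithm\<close>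

lemma info_left:
  assumes "pos v \<noteq> l - 1"
  shows "info x y v = info x y' v"
proof -
  have "wt x y e = wt x y' e" if "v \<in> e" for e
  proof -
    \<comment> \<open>A rung lies on a single position, so \<open>v\<close> sees a weight that
      depends on \<open>y\<close> only if its own position is \<open>l - 1\<close>.\<close>
    have "pos v = j" if "e = rung i j" for i j
      using \<open>v \<in> e\<close> that by (auto simp: rung_def)
    then show ?thesis using assms unfolding wt_def by (intro if_cong) auto
  qed
  then show ?thesis by (auto simp: local_input_def)
qed

lemma info_right:
  assumes "pos v \<noteq> 1"
  shows "info x y v = info x' y v"
proof -
  have "wt x y e = wt x' y e" if "v \<in> e" for e
  proof -
    have "pos v = j" if "e = rung i j" for i j
      using \<open>v \<in> e\<close> that by (auto simp: rung_def)
    then show ?thesis using assms unfolding wt_def by (intro if_cong) auto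
  qed
  then show ?thesis by (auto simp: local_input_def)
qed

text \<open>After \<open>t\<close> rounds the first player still knows all vertices left of \<open>l - 1 - 2 * t\<close> and the
  second player all vertices from \<open>2 + 2 * t\<close> on; \<open>slots R\<close> are the only messages that have to be
  exchanged to keep this up for \<open>R\<close> rounds.\<close>

definition slots :: "nat \<Rightarrow> (nat \<times> nat \<times> nat) set" where
  "slots R = (SIGMA t:{..<R}. prod.swap ` crossing (l - 1 - 2 * t) \<union> crossing (2 + 2 * t))"

lemma finite_slots [simp]: "finite (slots R)"
  by (simp add: slots_def)

lemma card_slots: "card (slots R) \<le> 2 * q * R"
proof -
  have "card (slots R) = (\<Sum>t<R. card (prod.swap ` crossing (l - 1 - 2 * t) \<union> crossing (2 + 2 * t)))"
    by (simp add: slots_def)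
  also have "\<dots> \<le> (\<Sum>t<R. 2 * q)"
  proof (intro sum_mono)
    fix t
    have "card (prod.swap ` crossing (l - 1 - 2 * t) \<union> crossing (2 + 2 * t))
        \<le> card (prod.swap ` crossing (l - 1 - 2 * t)) + card (crossing (2 + 2 * t))"
      by (rule card_Un_le)
    also have "\<dots> \<le> q + q"
      using card_image_le[OF finite_crossing] card_crossing by (meson add_mono order_trans)
    finally show "card (prod.swap ` crossing (l - 1 - 2 * t) \<union> crossing (2 + 2 * t)) \<le> 2 * q" by simp
  qed
  finally show ?thesis by (simp add: mult_ac)
qed

context
  fixes A :: algorithm and c :: "nat \<Rightarrow> nat \<Rightarrow> bool" and R :: nat
begin

definition inb :: "nat set \<Rightarrow> nat set \<Rightarrow> nat \<Rightarrow> nat \<Rightarrow> (nat \<Rightarrow> msg) list" where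
  "inb x y t v = inboxes G (info x y) c A t v"

definition mess :: "nat set \<Rightarrow> nat set \<Rightarrow> nat \<Rightarrow> nat \<Rightarrow> nat \<Rightarrow> msg" where
  "mess x y t u v = send A (info x y u) (c u) (inb x y t u) v"

text \<open>\<open>restrict\<close> makes transcripts elements of a finite \<open>PiE\<close>, and
  their equality an agreement on \<open>slots R\<close> alone.\<close>

definition transcript :: "nat set \<Rightarrow> nat set \<Rightarrow> nat \<times> nat \<times> nat \<Rightarrow> msg" where
  "transcript x y = restrict (\<lambda>(t, u, v). mess x y t u v) (slots R)"

text \<open>Each vertex tests its own output against its own weights, so the verdict splits into
  parts that the two players can evaluate separately.\<close>

definition accepts :: "nat set \<Rightarrow> nat set \<Rightarrow> bool" where
  "accepts x y \<longleftrightarrow> (\<forall>v\<in>V. \<forall>e\<in>result A (info x y v) (c v) (inb x y R v). inc_weight (info x y v) e = 0)"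

lemma inb_Suc: "inb x y (Suc t) v = inb x y t v @ [\<lambda>u. if {u, v} \<in> edges G then mess x y t u v else []]"
  by (simp add: inb_def mess_def cong: if_cong)

lemma transcript_mess:
  "transcript x y = transcript x' y' \<Longrightarrow> (t, u, v) \<in> slots R \<Longrightarrow> mess x y t u v = mess x' y' t u v"
  by (drule fun_cong[of _ _ "(t, u, v)"]) (simp add: transcript_def)

context
  assumes R: "4 * R + 3 \<le> l"
begin

text \<open>On the mixed input the left part runs as on \<open>(x, y)\<close> and the right part as
  on \<open>(x', y')\<close>. Each frontier retreats by two positions per round, so a message from
  beyond the old frontier reaches a vertex within the new one only over a long edge; such messages
  are in \<open>slots R\<close>, where the transcripts agree.\<close>

lemma cut_and_paste:
  assumes tr: "transcript x y = transcript x' y'" and "t \<le> R"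
  shows "(\<forall>v. pos v < l - 1 - 2 * t \<longrightarrow> inb x y' t v = inb x y t v) \<and>
    (\<forall>v. 2 + 2 * t \<le> pos v \<longrightarrow> inb x y' t v = inb x' y' t v)"
  using \<open>t \<le> R\<close>
proof (induction t)
  case 0
  show ?case by (simp add: inb_def)
next
  case (Suc t)
  have left: "mess x y' t u v = mess x y t u v" if "pos u < l - 1 - 2 * t" for u v
    using Suc that info_left[of u x y y'] by (simp add: mess_def)
  have right: "mess x y' t u v = mess x' y' t u v" if "2 + 2 * t \<le> pos u" for u v
    using Suc that info_right[of u x y' x'] by (simp add: mess_def)
  show ?case
  proof (intro conjI allI impI)
    fix v assume v: "pos v < l - 1 - 2 * Suc t"
    have "mess x y' t u v = mess x y t u v" if "{u, v} \<in> edges G" for u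
    proof (cases "pos u < l - 1 - 2 * t")
      case False
      then have "(v, u) \<in> crossing (l - 1 - 2 * t)"
        using v that by (auto simp: crossing_def insert_commute)
      then have "(t, u, v) \<in> slots R" using Suc.prems by (force simp: slots_def)
      then have "mess x y t u v = mess x' y' t u v" by (rule transcript_mess[OF tr])
      \<comment> \<open>\<open>4 * R + 3 \<le> l\<close> makes the two zones cover all positions, so
        the sender lies in the right one.\<close>
      moreover have "mess x y' t u v = mess x' y' t u v"
        using False R Suc.prems by (intro right) linarith
      ultimately show ?thesis by simp
    qed (rule left)
    then show "inb x y' (Suc t) v = inb x y (Suc t) v"
      using Suc v by (auto simp: inb_Suc)
  next
    fix v assume v: "2 + 2 * Suc t \<le> pos v"
    have "mess x y' t u v = mess x' y' t u v" if "{u, v} \<in> edges G" for u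
    proof (cases "2 + 2 * t \<le> pos u")
      case False
      then have "(u, v) \<in> crossing (2 + 2 * t)"
        using v that by (auto simp: crossing_def)
      then have "(t, u, v) \<in> slots R" using Suc.prems by (force simp: slots_def)
      then have "mess x y t u v = mess x' y' t u v" by (rule transcript_mess[OF tr])
      moreover have "mess x y' t u v = mess x y t u v"
        using False R Suc.prems by (intro left) linarith
      ultimately show ?thesis by simp
    qed (rule right)
    then show "inb x y' (Suc t) v = inb x' y' (Suc t) v"
      using Suc v by (auto simp: inb_Suc)
  qed
qed

lemma transcript_rectangle:
  assumes tr: "transcript x y = transcript x' y'"
  shows "transcript x y' = transcript x y"
proof -
  have "mess x y' t u v = mess x y t u v" if s: "(t, u, v) \<in> slots R" for t u v
  proof -
    have t: "t < R" using s by (auto simp: slots_def)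
    note cp = cut_and_paste[OF tr less_imp_le[OF t]]
    show ?thesis
    proof (cases "pos u < l - 1 - 2 * t")
      case True
      then show ?thesis using cp info_left[of u x y y'] by (simp add: mess_def)
    next
      case False
      then have "2 + 2 * t \<le> pos u" using R t by linarith
      then have "mess x y' t u v = mess x' y' t u v"
        using cp info_right[of u x y' x'] by (simp add: mess_def)
      then show ?thesis using transcript_mess[OF tr s] by simp
    qed
  qed
  then show ?thesis unfolding transcript_def by (intro restrict_ext) auto
qed

text \<open>By the bound on \<open>R\<close> every vertex still lies in a zone where its view, and
  hence its test, is that of an accepting run.\<close>

lemma accepts_rectangle:
  assumes tr: "transcript x y = transcript x' y'" and acc: "accepts x y" "accepts x' y'"
  shows "accepts x y'"
  unfolding accepts_def
proof (intro ballI)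
  fix v e assume v: "v \<in> V" and e: "e \<in> result A (info x y' v) (c v) (inb x y' R v)"
  note cp = cut_and_paste[OF tr order_refl]
  show "inc_weight (info x y' v) e = 0"
  proof (cases "pos v < l - 1 - 2 * R")
    case True
    then have "info x y' v = info x y v" by (intro info_left) auto
    then show ?thesis using True cp acc(1) v e by (auto simp: accepts_def)
  next
    case False
    then have "2 + 2 * R \<le> pos v" using R by linarith
    moreover from this have "info x y' v = info x' y' v" by (intro info_right) auto
    ultimately show ?thesis using cp acc(2) v e by (auto simp: accepts_def)
  qed
qed

end

text \<open>With optimum \<open>0\<close> the approximation factor is harmless: the cost is at most
  \<open>a * 0\<close>, whatever \<open>a\<close> is. If the sets meet,
  \<open>augmentation_heavy_edge\<close> gives a vertex whose test fails.\<close>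

lemma accepts_iff_disjoint:
  assumes succ: "run_succeeds G T (vx 0 0) (wt x y) a A R c" and x: "x \<subseteq> {1..N}"
  shows "accepts x y \<longleftrightarrow> x \<inter> y = {}"
proof -
  from succ obtain Aug where aug: "approx_augmentation G T (wt x y) a Aug"
    and res: "\<And>v. v \<in> V \<Longrightarrow> result A (info x y v) (c v) (inb x y R v) = {e \<in> Aug. v \<in> e}"
    unfolding run_succeeds_def Let_def inb_def by auto
  have aug': "augmentation G T Aug" and sub: "Aug \<subseteq> edges G"
    using aug by (auto simp: approx_augmentation_def augmentation_def)
  have inc: "inc_weight (info x y v) e = wt x y e" if "e \<in> Aug" "v \<in> e" for v e
    using that sub by (auto simp: local_input_def)
  have acc: "accepts x y \<longleftrightarrow> (\<forall>v\<in>V. \<forall>e\<in>Aug. v \<in> e \<longrightarrow> wt x y e = 0)"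
    unfolding accepts_def using inc by (auto simp: res)
  show ?thesis
  proof
    assume disj: "x \<inter> y = {}"
    have "real (\<Sum>e\<in>Aug. wt x y e) \<le> a * real (tap_opt G T (wt x y))"
      using aug by (simp add: approx_augmentation_def)
    then have "(\<Sum>e\<in>Aug. wt x y e) = 0"
      by (simp only: tap_opt_eq_0[OF disj] of_nat_0 mult_zero_right of_nat_le_0_iff)
    moreover have "finite Aug" using sub finite_edges unfolding edges_G by (rule finite_subset)
    ultimately show "accepts x y" unfolding acc by auto
  next
    assume a: "accepts x y"
    show "x \<inter> y = {}"
    proof (rule ccontr)
      assume "x \<inter> y \<noteq> {}"
      then obtain i where "i \<in> x" "i \<in> y" by auto
      with x augmentation_heavy_edge[OF aug', of i x y] a acc show False
        by (metis atLeastAtMost_iff subsetD)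
    qed
  qed
qed

end

text \<open>The algorithm is read as a protocol for disjointness on \<open>{1..N}\<close> with
  public coins; a transcript chooses one of at most \<open>2 ^ Suc B\<close> words for each of at
  most \<open>2 * q * R\<close> slots.\<close>

lemma communication_bound:
  fixes \<epsilon> \<eta> :: real
  assumes alg: "tap_algorithm G T (vx 0 0) k a \<epsilon> A B R" and R: "4 * R + 3 \<le> l"
    and \<epsilon>: "\<epsilon> < 1" and \<eta>: "0 < \<eta>" "\<eta> \<le> 1 / 8"
  shows "(1 - \<epsilon>) * (1 - 8 * \<eta>) - \<epsilon> * ((1 + \<eta>) / (1 - \<eta>))\<^sup>2
    \<le> 8 * 2 ^ (Suc B * (2 * q * R)) * exp (- (\<eta> ^ 3 / 4 * N))"
proof -
  define \<Gamma> where "\<Gamma> = PiE (slots R) (\<lambda>_. {w :: bool list. length w \<le> B})"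
  define S where "S x y = {c \<in> space (coin_space G). run_succeeds G T (vx 0 0) (wt x y) a A R c}" for x y
  have "(1 - \<epsilon>) * (1 - 8 * \<eta>) - \<epsilon> * ((1 + \<eta>) / (1 - \<eta>))\<^sup>2
      \<le> 8 * card \<Gamma> * exp (- (\<eta> ^ 3 / 4 * card {1..N}))"
  proof (rule disjointness_transcripts[where S = S and acc = "\<lambda>c. accepts A c R" and tr = "\<lambda>c. transcript A c R"])
    show "finite {1..N}" "{1..N} \<noteq> {}" using N by auto
    show "prob_space (coin_space G)" by (rule prob_space_coin_space)
    show "finite \<Gamma>" unfolding \<Gamma>_def by (intro finite_PiE) (auto simp: finite_words)
    show "1 - \<epsilon> \<le> measure (coin_space G) (S x y)" for x y
      using alg weight_fun_wt unfolding tap_algorithm_def S_def by blast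
    show "accepts A c R x y \<longleftrightarrow> x \<inter> y = {}" if "x \<subseteq> {1..N}" "c \<in> S x y" for c x y
      using that R accepts_iff_disjoint[of x y a A R c] by (auto simp: S_def)
    show "transcript A c R x y \<in> \<Gamma>" if "c \<in> space (coin_space G)" for c x y
    proof -
      have "length (mess A c x y t u v) \<le> B" if "(t, u, v) \<in> slots R" for t u v
      proof -
        have "t < R" "{u, v} \<in> edges G"
          using that by (auto simp: slots_def crossing_def insert_commute)
        then show ?thesis
          using alg weight_fun_wt \<open>c \<in> space (coin_space G)\<close>
          unfolding tap_algorithm_def bandwidth_respected_def Let_def mess_def inb_def by blast
      qed
      then show ?thesis by (auto simp: \<Gamma>_def transcript_def)
    qed
    show "accepts A c R x y' \<and> transcript A c R x y' = transcript A c R x y"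
      if "accepts A c R x y" "accepts A c R x' y'" "transcript A c R x y = transcript A c R x' y'" for c x y x' y'
      using accepts_rectangle[OF R that(3,1,2)] transcript_rectangle[OF R that(3)] by simp
  qed (use \<epsilon> \<eta> in auto)
  also have "\<dots> \<le> 8 * 2 ^ (Suc B * (2 * q * R)) * exp (- (\<eta> ^ 3 / 4 * N))"
  proof -
    have "card \<Gamma> = card {w :: bool list. length w \<le> B} ^ card (slots R)"
      unfolding \<Gamma>_def by (simp add: card_PiE)
    also have "\<dots> \<le> (2 ^ Suc B) ^ card (slots R)"
      by (intro power_mono card_words_le) simp
    also have "\<dots> \<le> (2 ^ Suc B) ^ (2 * q * R)"
      by (intro power_increasing card_slots) simp
    finally have "card \<Gamma> \<le> 2 ^ (Suc B * (2 * q * R))"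
      by (simp only: power_mult)
    then have "real (card \<Gamma>) \<le> 2 ^ (Suc B * (2 * q * R))"
      by (metis of_nat_le_iff of_nat_numeral of_nat_power)
    then show ?thesis by (auto intro!: mult_right_mono)
  qed
  finally show ?thesis .
qed

end

section \<open>Asymptotics\<close>

definition legs :: "nat \<Rightarrow> nat" where
  "legs n = nat \<lceil>sqrt n * ln n\<rceil> + 1"

definition leg_length :: "nat \<Rightarrow> nat" where
  "leg_length n = nat \<lceil>sqrt n / ln n\<rceil> + 4"

definition tail_length :: "nat \<Rightarrow> nat" where
  "tail_length n = nat \<lceil>ln n\<rceil> + 1"

definition skip_levels :: "nat \<Rightarrow> nat" where
  "skip_levels n = nat \<lceil>log 2 (leg_length n)\<rceil>"

text \<open>The additive constants in the parameters make the instance valid for every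
  \<open>n\<close>, also where \<open>ln n\<close> is \<open>0\<close>.\<close>

lemma comb_params: "comb (legs n) (leg_length n) (tail_length n) (skip_levels n)"
proof
  have "real (leg_length n) = 2 powr log 2 (leg_length n)"
    by (simp add: leg_length_def)
  also have "\<dots> \<le> 2 powr skip_levels n"
    unfolding skip_levels_def by (intro powr_mono) (auto simp: real_nat_ceiling_ge)
  also have "\<dots> = real (2 ^ skip_levels n)"
    by (simp add: powr_realpow)
  finally show "leg_length n \<le> 2 ^ skip_levels n"
    by (simp only: of_nat_le_iff)
qed (auto simp: legs_def leg_length_def tail_length_def)

lemma real_nat_ceiling_le: "0 \<le> x \<Longrightarrow> real (nat \<lceil>x\<rceil>) \<le> x + 1"
  by linarith

lemma param_bounds:
  assumes "3 \<le> n"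
  shows "sqrt n * ln n \<le> legs n" "legs n \<le> sqrt n * ln n + 2"
    "sqrt n / ln n + 4 \<le> leg_length n" "leg_length n \<le> sqrt n / ln n + 5"
    "ln n \<le> tail_length n" "tail_length n \<le> ln n + 2"
    "skip_levels n \<le> 2 * ln (sqrt n / ln n + 5) + 1"
proof -
  have ln: "0 < ln (real n)" using assms by simp
  then have nonneg: "0 \<le> sqrt n * ln n" "0 \<le> sqrt n / ln n" by auto
  show "sqrt n * ln n \<le> legs n" "legs n \<le> sqrt n * ln n + 2"
    using real_nat_ceiling_ge[of "sqrt n * ln n"] real_nat_ceiling_le[OF nonneg(1)] by (auto simp: legs_def)
  show len: "sqrt n / ln n + 4 \<le> leg_length n" "leg_length n \<le> sqrt n / ln n + 5"
    using real_nat_ceiling_ge[of "sqrt n / ln n"] real_nat_ceiling_le[OF nonneg(2)] by (auto simp: leg_length_def)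
  show "ln n \<le> tail_length n" "tail_length n \<le> ln n + 2"
    using real_nat_ceiling_ge[of "ln n"] real_nat_ceiling_le[OF less_imp_le[OF ln]]
    unfolding tail_length_def of_nat_add of_nat_1 by linarith+
  have "1 \<le> leg_length n" by (simp add: leg_length_def)
  then have "skip_levels n \<le> log 2 (leg_length n) + 1"
    unfolding skip_levels_def by (intro real_nat_ceiling_le) simp
  also have "log 2 (leg_length n) \<le> log 2 (sqrt n / ln n + 5)"
    using len(2) \<open>1 \<le> leg_length n\<close> by (intro log_mono) auto
  \<comment> \<open>As \<open>2 * ln 2\<close> is at least \<open>1\<close>, passing to the natural
    logarithm costs at most a factor \<open>2\<close>.\<close>
  also have "\<dots> \<le> 2 * ln (sqrt n / ln n + 5)"
  proof -
    have "0 \<le> ln (sqrt n / ln n + 5)" using nonneg by simp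
    then show ?thesis
      using ln2_ge_two_thirds mult_left_mono[of 1 "2 * ln 2" "ln (sqrt n / ln n + 5)"]
      by (simp add: log_def field_simps)
  qed
  finally show "skip_levels n \<le> 2 * ln (sqrt n / ln n + 5) + 1" by simp
qed

section \<open>Size, diameter and height of the instances\<close>

definition tap_graph :: "nat \<Rightarrow> ugraph" where
  "tap_graph n = comb.G (legs n) (leg_length n) (tail_length n)"

definition tap_tree :: "nat \<Rightarrow> nat set set" where
  "tap_tree n = comb.T (legs n) (leg_length n) (tail_length n)"

lemma card_tap_graph: "(\<lambda>n. real (card (verts (tap_graph n)))) \<in> \<Theta>(\<lambda>n. real n)"
proof (rule bigthetaI')
  have "\<forall>\<^sub>F n in sequentially. (sqrt (real n) * ln n + 3) * (sqrt n / ln n + 5) + (ln n + 2) \<le> 2 * n"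
    by real_asymp
  then show "\<forall>\<^sub>F n in sequentially. 1 * norm (real n) \<le> norm (real (card (verts (tap_graph n)))) \<and>
      norm (real (card (verts (tap_graph n)))) \<le> 2 * norm (real n)"
    using eventually_ge_at_top[of 3]
  proof eventually_elim
    case (elim n)
    note b = param_bounds[OF elim(2)]
    have ln: "0 < ln (real n)" using elim by simp
    have card: "real (card (verts (tap_graph n))) = (legs n + 1) * leg_length n + tail_length n"
      using comb.card_V[OF comb_params, of n] comb.verts_G[OF comb_params, of n] by (simp add: tap_graph_def)
    have "(legs n + 1) * leg_length n \<le> (sqrt n * ln n + 3) * (sqrt n / ln n + 5)"
      using b ln by (simp only: of_nat_mult, intro mult_mono) auto
    with b(6) elim(1) have "real (card (verts (tap_graph n))) \<le> 2 * n"
      unfolding card by linarith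
    \<comment> \<open>The factors \<open>ln n\<close> cancel, so that the product of the two lower
      bounds is \<open>n\<close>.\<close>
    moreover have "sqrt n * ln n * (sqrt n / ln n) \<le> real (legs n + 1) * leg_length n"
      using b ln by (intro mult_mono) auto
    then have "real n \<le> card (verts (tap_graph n))"
      unfolding card using ln by (simp add: algebra_simps)
    ultimately show ?case by simp
  qed
qed auto

lemma diameter_tap_graph: "(\<lambda>n. real (graph_diameter (tap_graph n))) \<in> \<Theta>(\<lambda>n. ln (real n))"
proof (rule bigthetaI')
  have "\<forall>\<^sub>F n in sequentially. 2 * ((2 * ln (sqrt (real n) / ln n + 5) + 1) + (ln n + 2) + 1) \<le> 20 * ln n"
    by real_asymp
  then show "\<forall>\<^sub>F n in sequentially. 1 / 2 * norm (ln (real n)) \<le> norm (real (graph_diameter (tap_graph n))) \<and>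
      norm (real (graph_diameter (tap_graph n))) \<le> 20 * norm (ln (real n))"
    using eventually_ge_at_top[of 3]
  proof eventually_elim
    case (elim n)
    note b = param_bounds[OF elim(2)]
    have ln: "0 < ln (real n)" using elim by simp
    have "real (tail_length n) \<le> real (2 * graph_diameter (tap_graph n))"
      "real (graph_diameter (tap_graph n)) \<le> real (2 * (skip_levels n + tail_length n + 1))"
      unfolding tap_graph_def of_nat_le_iff
      by (rule comb.diameter_ge[OF comb_params] comb.diameter_le[OF comb_params])+
    then show ?case using b elim(1) ln by simp
  qed
qed auto

lemma height_bounds:
  "\<forall>\<^sub>F n in sequentially. sqrt (real n) / ln n \<le> tree_height (tap_graph n) (tap_tree n) (vx 0 0) \<and>
      tree_height (tap_graph n) (tap_tree n) (vx 0 0) \<le> 2 * (sqrt n / ln n)"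
proof -
  have "\<forall>\<^sub>F n in sequentially. (sqrt (real n) / ln n + 5) + (ln n + 2) \<le> 2 * (sqrt n / ln n)"
    by real_asymp
  then show ?thesis
    using eventually_ge_at_top[of 3]
  proof eventually_elim
    case (elim n)
    note b = param_bounds[OF elim(2)]
    have "leg_length n \<le> tree_height (tap_graph n) (tap_tree n) (vx 0 0)"
      "tree_height (tap_graph n) (tap_tree n) (vx 0 0) \<le> leg_length n + tail_length n"
      unfolding tap_graph_def tap_tree_def
      by (rule comb.height_ge[OF comb_params] comb.height_le[OF comb_params])+
    then show ?case using b elim(1) by linarith
  qed
qed

text \<open>Either \<open>R n\<close> exceeds about a quarter of the leg length, or
  \<open>communication_bound\<close> applies and bounds \<open>\<delta> * legs n\<close>, up to a
  constant, by a multiple of \<open>ln n * ln n * R n\<close>. As \<open>legs n\<close> is at least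
  \<open>ln n * ln n\<close> times \<open>sqrt n / ln n\<close>, both cases suffice.\<close>

lemma rounds_bound:
  fixes A :: "nat \<Rightarrow> algorithm" and a :: "nat \<Rightarrow> real"
  assumes \<epsilon>: "\<epsilon> < 1 / 2" and B: "(\<lambda>n. real (B n)) \<in> O(\<lambda>n. ln (real n))"
    and alg: "\<forall>\<^sub>F n in sequentially. tap_algorithm (tap_graph n) (tap_tree n) (vx 0 0) k (a n) \<epsilon> (A n) (B n) (R n)"
  shows "(\<lambda>n. real (R n)) \<in> \<Omega>(\<lambda>n. sqrt (real n) / ln n)"
proof -
  obtain \<eta> where \<eta>: "0 < \<eta>" "\<eta> \<le> 1 / 8" "0 < (1 - \<epsilon>) * (1 - 8 * \<eta>) - \<epsilon> * ((1 + \<eta>) / (1 - \<eta>))\<^sup>2"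
    using disjointness_constant[OF \<epsilon>] .
  define C where "C = (1 - \<epsilon>) * (1 - 8 * \<eta>) - \<epsilon> * ((1 + \<eta>) / (1 - \<eta>))\<^sup>2"
  define \<delta> where "\<delta> = \<eta> ^ 3 / 4"
  have C: "0 < C" and \<delta>: "0 < \<delta>" using \<eta> by (simp_all add: C_def \<delta>_def)
  obtain K where K: "0 < K" and B_le: "\<forall>\<^sub>F n in sequentially. norm (real (B n)) \<le> K * norm (ln (real n))"
    using B by (rule landau_o.bigE)
  \<comment> \<open>The two values serve the two cases. \<open>20 * (K + 1)\<close> combines
    \<open>Suc (B n) \<le> (K + 1) * ln n\<close>, at most \<open>5 * ln n\<close> skip levels, at
    most two messages per level and round, and the half of \<open>\<delta>\<close> given up in
    \<open>absorb\<close>.\<close>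
  define c where "c = min (1 / 4) (\<delta> / (20 * (K + 1)))"
  have c: "0 < c" using \<delta> K by (simp add: c_def)
  have c_le: "c \<le> 1 / 4" "c \<le> \<delta> / (20 * (K + 1))"
    unfolding c_def by (rule min.cobounded1 min.cobounded2)+
  have levels: "\<forall>\<^sub>F n in sequentially. 2 * ln (sqrt (real n) / ln n + 5) + 1 \<le> 5 * ln n"
    by real_asymp
  \<comment> \<open>Half of the main term absorbs the constant \<open>ln (C / 8)\<close>, which may
    be negative.\<close>
  have absorb: "\<forall>\<^sub>F n in sequentially. \<delta> / 2 * (sqrt (real n) * ln n) \<le> \<delta> * (sqrt n * ln n) + ln (C / 8)"
    using \<delta> by real_asymp
  have "\<forall>\<^sub>F n in sequentially. c * norm (sqrt (real n) / ln n) \<le> norm (real (R n))"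
    using alg B_le levels absorb eventually_ge_at_top[of 3]
  proof eventually_elim
    case (elim n)
    define L where "L = ln (real n)"
    define h where "h = sqrt n / ln n"
    note b = param_bounds[OF elim(5)]
    \<comment> \<open>\<open>1 \<le> L\<close> is what lets the successor in
      \<open>Suc (B n)\<close> be absorbed into \<open>(K + 1) * L\<close>.\<close>
    have "exp 1 \<le> real n" using elim(5) exp_le by linarith
    then have L: "1 \<le> L" using elim(5) by (simp add: L_def ln_ge_iff)
    have h: "0 \<le> h" using L by (simp add: h_def L_def)
    have "c * h \<le> R n"
    proof (cases "4 * R n + 3 \<le> leg_length n")
      case False
      then have "leg_length n < 4 * real (R n) + 3" by linarith
      with b(3) have "1 / 4 * h \<le> R n" by (simp add: h_def)
      moreover have "c * h \<le> 1 / 4 * h" using h c_le by (intro mult_right_mono)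
      ultimately show ?thesis by linarith
    next
      case True
      define X where "X = Suc (B n) * (2 * skip_levels n * R n)"
      have "C \<le> 8 * 2 ^ X * exp (- (\<delta> * legs n))"
        unfolding C_def \<delta>_def X_def using elim(1) True \<eta> \<epsilon>
        by (intro comb.communication_bound[OF comb_params]) (auto simp: tap_graph_def tap_tree_def)
      then have "C / 8 \<le> 2 ^ X * exp (- (\<delta> * legs n))" by simp
      then have "ln (C / 8) \<le> ln (2 ^ X * exp (- (\<delta> * legs n)))"
        using C by (subst ln_le_cancel_iff) auto
      also have "\<dots> = X * ln 2 - \<delta> * legs n"
        by (simp add: ln_mult ln_realpow)
      finally have "\<delta> * legs n + ln (C / 8) \<le> X * ln 2" by simp
      also have "\<dots> \<le> real X * 1"
        using ln_2_less_1 by (intro mult_left_mono) auto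
      finally have "\<delta> * legs n + ln (C / 8) \<le> X" by simp
      moreover have "\<delta> * (sqrt n * ln n) \<le> \<delta> * legs n"
        using b(1) \<delta> by (intro mult_left_mono) auto
      ultimately have "\<delta> / 2 * (sqrt n * ln n) \<le> X"
        using elim(4) by linarith
      also have "sqrt n * ln n = L * L * h"
        using L by (simp add: L_def h_def)
      also have "real X \<le> ((K + 1) * L) * (2 * (5 * L) * R n)"
      proof -
        have 1: "real (Suc (B n)) \<le> (K + 1) * L"
          using elim(2) L by (simp add: L_def algebra_simps)
        have 2: "real (2 * skip_levels n * R n) \<le> 2 * (5 * L) * R n"
          unfolding of_nat_mult using b(7) elim(3) by (intro mult_right_mono) (auto simp: L_def)
        show ?thesis
          unfolding X_def of_nat_mult[of "Suc (B n)"] using K L by (intro mult_mono[OF 1 2]) auto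
      qed
      also have "\<dots> = (L * L) * (10 * (K + 1) * R n)" by simp
      finally have "(L * L) * (\<delta> / 2 * h) \<le> (L * L) * (10 * (K + 1) * R n)"
        by (simp add: mult_ac)
      then have "\<delta> / 2 * h \<le> 10 * (K + 1) * R n"
        using L by (subst (asm) mult_le_cancel_left_pos) auto
      then have "\<delta> / (20 * (K + 1)) * h \<le> R n"
        using K by (simp add: field_simps)
      moreover have "c * h \<le> \<delta> / (20 * (K + 1)) * h"
        using h c_le by (intro mult_right_mono)
      ultimately show ?thesis by linarith
    qed
    then show ?case using h L by (simp add: h_def L_def)
  qed
  with c show ?thesis by (rule landau_omega.bigI)
qed

theorem theorem5:
  fixes \<alpha> :: "nat \<Rightarrow> real"
  assumes "\<exists>d. \<alpha> \<in> O(\<lambda>n. real n ^ d)"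
  shows "\<exists>(G :: nat \<Rightarrow> ugraph) (T :: nat \<Rightarrow> nat set set) (r :: nat \<Rightarrow> nat).
    (\<forall>n. simple_graph (G n) \<and> two_edge_connected (G n) \<and>
         spanning_tree (G n) (T n) \<and> r n \<in> verts (G n)) \<and>
    (\<lambda>n. real (card (verts (G n)))) \<in> \<Theta>(\<lambda>n. real n) \<and>
    (\<lambda>n. real (graph_diameter (G n))) \<in> \<Theta>(\<lambda>n. ln (real n)) \<and>
    (\<lambda>n. real (tree_height (G n) (T n) (r n))) \<in> \<Theta>(\<lambda>n. sqrt (real n) / ln (real n)) \<and>
    (\<forall>(k :: nat) (\<epsilon> :: real) (A :: nat \<Rightarrow> algorithm) (B :: nat \<Rightarrow> nat) (R :: nat \<Rightarrow> nat).
       1 \<le> k \<and> 0 \<le> \<epsilon> \<and> \<epsilon> < 1 / 2 \<and>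
       (\<lambda>n. real (B n)) \<in> O(\<lambda>n. ln (real n)) \<and>
       (\<forall>\<^sub>F n in sequentially.
          tap_algorithm (G n) (T n) (r n) k (\<alpha> (card (verts (G n)))) \<epsilon> (A n) (B n) (R n)) \<longrightarrow>
       (\<lambda>n. real (R n)) \<in> \<Omega>(\<lambda>n. real (tree_height (G n) (T n) (r n))))"
proof -
  let ?h = "\<lambda>n. real (tree_height (tap_graph n) (tap_tree n) (vx 0 0))"
  have instance_ok: "simple_graph (tap_graph n)" "two_edge_connected (tap_graph n)"
    "spanning_tree (tap_graph n) (tap_tree n)" "vx 0 0 \<in> verts (tap_graph n)" for n
    unfolding tap_graph_def tap_tree_def comb.verts_G[OF comb_params]
    by (rule comb.simple_G comb.two_edge_connected_G comb.spanning_tree_T comb.root_in_V, rule comb_params)+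
  have height: "?h \<in> \<Theta>(\<lambda>n. sqrt (real n) / ln (real n))"
  proof (rule bigthetaI')
    show "\<forall>\<^sub>F n in sequentially. 1 * norm (sqrt (real n) / ln n) \<le> norm (?h n) \<and>
        norm (?h n) \<le> 2 * norm (sqrt (real n) / ln n)"
      using height_bounds eventually_ge_at_top[of 3] by eventually_elim auto
  qed auto
  have rounds: "(\<lambda>n. real (R n)) \<in> \<Omega>(?h)"
    if "\<epsilon> < 1 / 2" "(\<lambda>n. real (B n)) \<in> O(\<lambda>n. ln (real n))"
      "\<forall>\<^sub>F n in sequentially. tap_algorithm (tap_graph n) (tap_tree n) (vx 0 0) k
         (\<alpha> (card (verts (tap_graph n)))) \<epsilon> (A n) (B n) (R n)"
    for k \<epsilon> A B R
    using rounds_bound[OF that] landau_omega.big.cong_bigtheta[OF height] by simp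
  show ?thesis
    using instance_ok card_tap_graph diameter_tap_graph height rounds
    by (intro exI[of _ tap_graph] exI[of _ tap_tree] exI[of _ "\<lambda>_. vx 0 0"]) blast
qed

end
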